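(* Let $q>1$, let $\Pi_n\sim\mathrm{Mallows}(n,q)$ and $\Sigma\sim\mathrm{Mallows}(\mathbb{Z},1/q)$. Then, in the sense of convergence of finite-dimensional distributions, $$(C_1(\Pi_{2n+1}),C_3(\Pi_{2n+1}),\ldots)\xrightarrow[n\to\infty]{d}(C_1(r\circ\Sigma),C_3(r\circ\Sigma),\ldots)$$ and $$(C_1(\Pi_{2n}),C_3(\Pi_{2n}),\ldots)\xrightarrow[n\to\infty]{d}(C_1(\rho\circ\Sigma),C_3(\rho\circ\Sigma),\ldots).$$ Moreover, the two limiting distributions are distinct for every $q>1$.
   Context: For a finite set $A\subseteq\mathbb{Z}$ and a bijection $\pi:A\to A$, $\mathrm{inv}(\pi)$ is the number of pairs $i<j$ in $A$ with $\pi(i)>\pi(j)$, and $\Pi_A\sim\mathrm{Mallows}(A,q)$ means $\mathbb{P}(\Pi_A=\pi)\propto q^{\mathrm{inv}(\pi)}$ over bijections $\pi$ of $A$; $\mathrm{Mallows}(n,q):=\mathrm{Mallows}([n],q)$ with $[n]=\{1,\dots,n\}$. For a bijection $\sigma$ of a set $B\subseteq\mathbb{Z}$ and finite $A\subseteq B$, the pattern $\sigma_A:A\to A$ is defined by $\sigma_A(a)=a_{(i)}$ when $\sigma(a)$ is the $i$-th smallest element of $\sigma[A]$, where $a_{(i)}$ is the $i$-th smallest element of $A$. For $0<q<1$, $\mathrm{Mallows}(\mathbb{Z},q)$ is Gnedin and Olshanski's bi-infinite Mallows measure: the law of a random bijection $\Sigma$ of $\mathbb{Z}$ such that $\Sigma_I\sim\mathrm{Mallows}(I,q)$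 for every finite interval of integers $I$, and, with $I_n=\{-n,\dots,n\}$, almost surely for every $i\in\mathbb{Z}$ one has $\Sigma_{I_n}(i)=\Sigma(i)$ for all sufficiently large $n$ (so the law of $\Sigma$ is the limit of the laws $\mathrm{Mallows}(I_n,q)$). $C_i(\pi)$ denotes the number of cycles of length $i$ of a permutation $\pi$ (possibly of $\mathbb{Z}$). The maps $r,\rho:\mathbb{Z}\to\mathbb{Z}$ are $r(i)=-i$, $\rho(i)=1-i$. *)

theory Defs
  imports "HOL-Probability.Probability" "HOL-Combinatorics.Permutations"
begin

definition inversions :: "int set \<Rightarrow> (int \<Rightarrow> int) \<Rightarrow> nat" where
  "inversions A p = card {(i, j). i \<in> A \<and> j \<in> A \<and> i < j \<and> p i > p j}"

definition mallows :: "int set \<Rightarrow> real \<Rightarrow> (int \<Rightarrow> int) pmf" where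
  "mallows A q = embed_pmf (\<lambda>p. if p permutes A
      then q ^ inversions A p / (\<Sum>s\<in>{s. s permutes A}. q ^ inversions A s) else 0)"

definition pattern :: "int set \<Rightarrow> (int \<Rightarrow> int) \<Rightarrow> (int \<Rightarrow> int)" where
  "pattern A s a = (if a \<in> A then sorted_list_of_set A ! card {b \<in> A. s b < s a} else a)"

definition cyc_pts :: "int set \<Rightarrow> nat \<Rightarrow> (int \<Rightarrow> int) \<Rightarrow> int set" where
  "cyc_pts D i p = {x \<in> D. (p ^^ i) x = x \<and> (\<forall>j. 0 < j \<and> j < i \<longrightarrow> (p ^^ j) x \<noteq> x)}"

definition cycles_len :: "int set \<Rightarrow> nat \<Rightarrow> (int \<Rightarrow> int) \<Rightarrow> int set set" where
  "cycles_len D i p = (\<lambda>x. {(p ^^ j) x | j. j < i}) ` cyc_pts D i p"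

definition cycle_count :: "int set \<Rightarrow> nat \<Rightarrow> (int \<Rightarrow> int) \<Rightarrow> enat" where
  "cycle_count D i p = (if finite (cycles_len D i p) then enat (card (cycles_len D i p)) else \<infinity>)"

definition odd_cycles :: "int set \<Rightarrow> nat \<Rightarrow> (int \<Rightarrow> int) \<Rightarrow> enat list" where
  "odd_cycles D k p = map (\<lambda>j. cycle_count D (2 * j + 1) p) [0..<k]"

definition refl_r :: "int \<Rightarrow> int" where "refl_r i = - i"
definition refl_rho :: "int \<Rightarrow> int" where "refl_rho i = 1 - i"

text \<open>Sigma (a random map on the probability space M) has law Mallows(Z,q) (0<q<1),
  characterised as in Gnedin--Olshanski.\<close>
definition is_mallows_Z :: "'a measure \<Rightarrow> ('a \<Rightarrow> int \<Rightarrow> int) \<Rightarrow> real \<Rightarrow> bool" where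
  "is_mallows_Z M S q \<longleftrightarrow>
     prob_space M \<and>
     S \<in> measurable M (PiM UNIV (\<lambda>_. count_space UNIV)) \<and>
     (AE w in M. bij (S w)) \<and>
     (\<forall>a b p. measure M {w \<in> space M. pattern {a..b} (S w) = p} = pmf (mallows {a..b} q) p) \<and>
     (AE w in M. \<forall>i. eventually (\<lambda>n. pattern {- int n..int n} (S w) i = S w i) sequentially)"

end

theory Submission
  imports Defs
begin

text \<open>
  Put \<open>p = 1/q\<close>, \<open>c = 0\<close> for \<open>r\<close> and \<open>c = 1\<close> for \<open>\<rho>\<close>. Reversing the values turns \<open>Mallows(2n + 1 - c, q)\<close>
  into \<open>Mallows({c - n..n}, p)\<close>, so \<open>\<Pi>\<close> is conjugate in law to the reflection \<open>x \<mapsto> c - x\<close> composed with a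
  pattern of \<open>\<Sigma>\<close>. The number of inversions of \<open>\<Sigma>\<close> involving a given point has a geometric tail, hence
  almost surely grows more slowly than any linear function of the position, and it bounds the displacement of \<open>\<Sigma>\<close>
  and of all its interval patterns. An odd cycle of the reflected map must therefore stay in a
  bounded window, on which the patterns eventually agree with \<open>\<Sigma>\<close>: the cycle counts converge almost surely.

  For the last claim, stationarity gives \<open>E C\<^sub>1(r \<circ> \<Sigma>) = P(\<Sigma>(0) even)\<close> and
  \<open>E C\<^sub>1(\<rho> \<circ> \<Sigma>) = P(\<Sigma>(0) odd)\<close>. Their difference is the mean of \<open>(-1)\<close> to the power \<open>\<Sigma>(0)\<close>. Weighted by
  \<open>\<Prod> (1 + p\<^sup>t)/(1 - p\<^sup>t)\<close> over \<open>1 \<le> t \<le> u\<close>, where \<open>u\<close> counts the values above that of \<open>0\<close>, this sign has a mean that changes by an explicit factor when a finite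
  permutation is extended to the right, and a functional equation shows that the limit is positive.
\<close>

section \<open>Patterns and odd cycles of a single bijection\<close>

text \<open>Inversions through \<open>y\<close> are split by side because, for injective
  \<open>s\<close>, each one-sided count is the displacement of an end point of a window, and that
  displacement has a geometric tail in the finite model.\<close>

definition right_smaller :: "int set \<Rightarrow> (int \<Rightarrow> int) \<Rightarrow> int \<Rightarrow> int set" where
  "right_smaller A s y = {b \<in> A. y < b \<and> s b < s y}"

definition left_larger :: "int set \<Rightarrow> (int \<Rightarrow> int) \<Rightarrow> int \<Rightarrow> int set" where
  "left_larger A s y = {b \<in> A. b < y \<and> s y < s b}"

section \<open>Ranks and displacements in interval patterns\<close>

lemma nth_sorted_list_of_set_interval:
  assumes "k < card {a..b::int}"
  shows "sorted_list_of_set {a..b} ! k = a + int k"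
  using assms sorted_list_of_set.idem_if_sorted_distinct[of "[a..b]"] by (simp add: nth_upto)

lemma card_below_less:
  fixes s :: "int \<Rightarrow> int"
  assumes "finite A" "y \<in> A"
  shows "card {b \<in> A. s b < s y} < card A"
  using assms by (intro psubset_card_mono) auto

lemma pattern_interval_rank:
  assumes "y \<in> {a..b}"
  shows "pattern {a..b} s y = a + int (card {c \<in> {a..b}. s c < s y})"
  using assms card_below_less[of "{a..b}" y s] nth_sorted_list_of_set_interval[of _ a b]
  by (simp add: pattern_def)

lemma pattern_interval_in:
  assumes "y \<in> {a..b}"
  shows "pattern {a..b} s y \<in> {a..b}"
  using card_below_less[of "{a..b}" y s] assms by (auto simp: pattern_interval_rank[OF assms])

text \<open>The rank of \<open>s y\<close> counts points on both sides of \<open>y\<close>, while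
  \<open>y - a\<close> counts all points to its left. On subtraction the points to the left with
  smaller value cancel, and only the two kinds of inversions through \<open>y\<close>
  remain.\<close>

lemma pattern_interval:
  assumes s: "inj s" and y: "y \<in> {a..b}"
  shows "pattern {a..b} s y
     = y + int (card (right_smaller {a..b} s y)) - int (card (left_larger {a..b} s y))"
proof -
  let ?A = "{a..b}"
  have 1: "{c \<in> ?A. s c < s y} = right_smaller ?A s y \<union> {c \<in> ?A. c < y \<and> s c < s y}"
    using injD[OF s] by (auto simp: right_smaller_def) (metis linorder_cases order_less_irrefl)
  have 2: "{a..<y} = left_larger ?A s y \<union> {c \<in> ?A. c < y \<and> s c < s y}"
    using injD[OF s] y
    by (auto simp: left_larger_def) (metis linorder_neqE_linordered_idom order_less_irrefl)
  have "card {c \<in> ?A. s c < s y} = card (right_smaller ?A s y) + card {c \<in> ?A. c < y \<and> s c < s y}"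
    unfolding 1 by (rule card_Un_disjoint) (auto simp: right_smaller_def intro: finite_subset[of _ ?A])
  moreover have "card {a..<y} = card (left_larger ?A s y) + card {c \<in> ?A. c < y \<and> s c < s y}"
    unfolding 2 by (rule card_Un_disjoint) (auto simp: left_larger_def intro: finite_subset[of _ ?A])
  moreover have "int (card {a..<y}) = y - a" using y by simp
  ultimately show ?thesis unfolding pattern_interval_rank[OF y] by linarith
qed

text \<open>Collects the almost sure properties on which the deterministic cycle argument rests. The
  slope \<open>1 / i\<close> is available for every \<open>i\<close> and will be matched to the
  cycle length.\<close>

definition tame :: "(int \<Rightarrow> int) \<Rightarrow> bool" where
  "tame s \<longleftrightarrow> inj s \<and>
     (\<forall>y. finite (right_smaller UNIV s y) \<and> finite (left_larger UNIV s y)) \<and>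
     (\<forall>i>0. \<exists>K. \<forall>y. int (card (right_smaller UNIV s y)) \<le> int K + \<bar>y\<bar> div int i \<and>
                    int (card (left_larger UNIV s y)) \<le> int K + \<bar>y\<bar> div int i) \<and>
     (\<forall>y. eventually (\<lambda>n. pattern {- int n..int n} s y = s y) sequentially)"

lemma finite_right_smaller: "finite A \<Longrightarrow> finite (right_smaller A s y)"
  and finite_left_larger: "finite A \<Longrightarrow> finite (left_larger A s y)"
  by (auto simp: right_smaller_def left_larger_def)

lemma right_smaller_mono: "A \<subseteq> B \<Longrightarrow> right_smaller A s y \<subseteq> right_smaller B s y"
  and left_larger_mono: "A \<subseteq> B \<Longrightarrow> left_larger A s y \<subseteq> left_larger B s y"
  by (auto simp: right_smaller_def left_larger_def)

definition refl_about :: "int \<Rightarrow> int \<Rightarrow> int" where "refl_about c i = c - i"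

lemma eventually_interval_superset:
  assumes "finite (F :: int set)"
  shows "eventually (\<lambda>n. F \<subseteq> {d - int n..e + int n}) sequentially"
proof -
  have "eventually (\<lambda>n. x \<in> {d - int n..e + int n}) sequentially" for x
    by (rule eventually_sequentiallyI[of "nat (\<bar>x\<bar> + \<bar>d\<bar> + \<bar>e\<bar>)"]) auto
  then show ?thesis
    using eventually_ball_finite[OF assms, of "\<lambda>n x. x \<in> {d - int n..e + int n}"] by (simp add: subset_iff Ball_def)
qed

text \<open>The last clause of \<open>tame\<close> concerns symmetric windows only. By
  \<open>pattern_interval\<close> the pattern at \<open>y\<close> is constant once the window
  contains \<open>y\<close> and all points inverted with it, and the symmetric windows identify this
  constant as \<open>s y\<close>.\<close>

lemma tame_eventually_pattern:
  assumes "tame s"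
  shows "eventually (\<lambda>n. pattern {d - int n..e + int n} s y = s y) sequentially"
proof -
  let ?F = "insert y (right_smaller UNIV s y \<union> left_larger UNIV s y)"
  let ?z = "y + int (card (right_smaller UNIV s y)) - int (card (left_larger UNIV s y))"
  have ev: "eventually (\<lambda>n. pattern {d - int n..e + int n} s y = ?z) sequentially" for d e
  proof -
    have "finite ?F" using assms by (simp add: tame_def)
    from eventually_interval_superset[OF this, of d e] show ?thesis
    proof eventually_elim
      case (elim n)
      then have "right_smaller {d - int n..e + int n} s y = right_smaller UNIV s y"
        "left_larger {d - int n..e + int n} s y = left_larger UNIV s y"
        by (auto simp: right_smaller_def left_larger_def)
      with elim show ?case using assms by (subst pattern_interval) (auto simp: tame_def)
    qed
  qed
  have "eventually (\<lambda>n. pattern {- int n..int n} s y = s y) sequentially"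
    using assms by (simp add: tame_def)
  with ev[of 0 0] have "eventually (\<lambda>n. s y = ?z) sequentially"
    by eventually_elim simp
  then have "s y = ?z" by simp
  with ev show ?thesis by simp
qed

text \<open>One \<open>K\<close> serves all windows because restriction to a window can only remove
  inversions; the bound for \<open>s\<close> itself follows by letting the window grow.\<close>

lemma tame_displacement:
  assumes "tame s" "i > 0"
  obtains K where "\<And>a b y. y \<in> {a..b} \<Longrightarrow> \<bar>pattern {a..b} s y - y\<bar> \<le> int K + \<bar>y\<bar> div int i"
    and "\<And>y. \<bar>s y - y\<bar> \<le> int K + \<bar>y\<bar> div int i"
proof -
  from assms obtain K where K: "\<And>y. int (card (right_smaller UNIV s y)) \<le> int K + \<bar>y\<bar> div int i"
     "\<And>y. int (card (left_larger UNIV s y)) \<le> int K + \<bar>y\<bar> div int i" unfolding tame_def by metis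
  have 1: "\<bar>pattern {a..b} s y - y\<bar> \<le> int K + \<bar>y\<bar> div int i" if y: "y \<in> {a..b}" for a b y
  proof -
    have "card (right_smaller {a..b} s y) \<le> card (right_smaller UNIV s y)"
      "card (left_larger {a..b} s y) \<le> card (left_larger UNIV s y)"
      using assms by (auto intro!: card_mono right_smaller_mono left_larger_mono simp: tame_def)
    with K[of y] show ?thesis using assms(1) by (subst pattern_interval[OF _ y]) (auto simp: tame_def)
  qed
  have 2: "\<bar>s y - y\<bar> \<le> int K + \<bar>y\<bar> div int i" for y
  proof -
    have "eventually (\<lambda>n. {y} \<subseteq> {0 - int n..0 + int n}) sequentially"
      by (rule eventually_interval_superset) simp
    with tame_eventually_pattern[OF assms(1), of 0 0 y]
    have "eventually (\<lambda>n. \<bar>s y - y\<bar> \<le> int K + \<bar>y\<bar> div int i) sequentially"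
    proof eventually_elim
      case (elim n) then show ?case using 1[of y "- int n" "int n"] by simp
    qed
    then show ?thesis by simp
  qed
  from 1 2 show thesis by (rule that)
qed

section \<open>Odd cycles of a reflected map\<close>

lemma funpow_periodic_shift:
  assumes "(g ^^ i) x = x" shows "(g ^^ i) ((g ^^ j) x) = (g ^^ j) x"
  by (metis assms comp_apply funpow_add add.commute)

lemma cyc_pts_orbit:
  assumes "x \<in> cyc_pts D i g" "g ` D \<subseteq> D"
  shows "(g ^^ j) x \<in> D"
proof (induction j)
  case 0 then show ?case using assms by (simp add: cyc_pts_def)
next
  case (Suc j) then show ?case using assms by auto
qed

text \<open>Apply the displacement bound to the point of the cycle farthest from the origin: after an odd
  number of near-reflections it returns to itself, so twice its modulus is at most the sum of
  the displacements.\<close>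
lemma odd_cycle_near_origin:
  fixes t :: "int \<Rightarrow> int"
  assumes i: "odd i"
    and disp: "\<And>y. y \<in> D \<Longrightarrow> \<bar>t y - y\<bar> \<le> int K + \<bar>y\<bar> div int i"
    and inv: "(refl_about c \<circ> t) ` D \<subseteq> D"
    and x: "x \<in> cyc_pts D i (refl_about c \<circ> t)"
  shows "\<bar>x\<bar> \<le> int i * (int K + \<bar>c\<bar>)"
proof -
  define g where "g = refl_about c \<circ> t"
  have i0: "i > 0" using i by (rule odd_pos)
  have per: "(g ^^ i) x = x" and inD: "\<And>j. (g ^^ j) x \<in> D"
    using x cyc_pts_orbit[OF x inv] by (auto simp: cyc_pts_def g_def)
  define R where "R = (\<lambda>j. \<bar>(g ^^ j) x\<bar>) ` {..<i}"
  have R: "finite R" "R \<noteq> {}" using i0 by (auto simp: R_def)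
  obtain j where j: "j < i" "\<bar>(g ^^ j) x\<bar> = Max R" using Max_in[OF R] by (auto simp: R_def)
  define z where "z = (g ^^ j) x"
  have bd: "\<bar>(g ^^ k) x\<bar> \<le> \<bar>z\<bar>" for k
  proof -
    have "(g ^^ k) x = (g ^^ (k mod i)) x" by (simp add: funpow_mod_eq per)
    moreover have "\<bar>(g ^^ (k mod i)) x\<bar> \<in> R" using i0 by (auto simp: R_def)
    ultimately show ?thesis using j R by (simp add: z_def)
  qed
  \<comment> \<open>\<open>B\<close> bounds the deviation of one step of \<open>g\<close> from
    negation, uniformly along the orbit.\<close>
  define B where "B = int K + \<bar>c\<bar> + \<bar>z\<bar> div int i"
  have step: "\<bar>(g ^^ Suc k) x + (g ^^ k) x\<bar> \<le> B" for k
  proof -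
    let ?y = "(g ^^ k) x"
    have "(g ^^ Suc k) x + ?y = c - (t ?y - ?y)" by (simp add: g_def refl_about_def)
    moreover have "\<bar>t ?y - ?y\<bar> \<le> int K + \<bar>?y\<bar> div int i" using disp inD by blast
    moreover have "\<bar>?y\<bar> div int i \<le> \<bar>z\<bar> div int i" using bd i0 by (intro zdiv_mono1) auto
    ultimately show ?thesis unfolding B_def by linarith
  qed
  have alt: "\<bar>(g ^^ (j + k)) x - (-1) ^ k * z\<bar> \<le> int k * B" for k
  proof (induction k)
    case 0 then show ?case by (simp add: z_def)
  next
    case (Suc k)
    have "(g ^^ (j + Suc k)) x - (-1) ^ Suc k * z
      = ((g ^^ Suc (j + k)) x + (g ^^ (j + k)) x) - ((g ^^ (j + k)) x - (-1) ^ k * z)" by simp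
    then show ?case using Suc step[of "j + k"] by (simp add: algebra_simps)
  qed
  \<comment> \<open>Since \<open>i\<close> is odd, \<open>(-1) ^ i * z\<close> is
    \<open>- z\<close>, so \<open>alt\<close> bounds \<open>\<bar>z - (- z)\<bar>\<close>.\<close>
  have "(g ^^ (j + i)) x = z" using per by (simp add: funpow_add z_def)
  with alt[of i] i have "2 * \<bar>z\<bar> \<le> int i * B" by auto
  also have "\<dots> = int i * (int K + \<bar>c\<bar>) + int i * (\<bar>z\<bar> div int i)"
    by (simp add: B_def algebra_simps)
  \<comment> \<open>The slope \<open>1 / i\<close> over \<open>i\<close> steps costs at most one
    \<open>\<bar>z\<bar>\<close>, which leaves the other one on the left-hand side.\<close>
  also have "int i * (\<bar>z\<bar> div int i) \<le> \<bar>z\<bar>"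
    using i0 mult_div_mod_eq[of "int i" "\<bar>z\<bar>"] pos_mod_sign[of "int i" "\<bar>z\<bar>"] by linarith
  finally show ?thesis using bd[of 0] by simp
qed

text \<open>Agreement of \<open>g\<close> and \<open>h\<close> is known on \<open>W\<close> only. It
  suffices because every point of the orbit of \<open>x\<close> again has exact period
  \<open>i\<close>, hence lies in \<open>W\<close>, so the two orbits coincide by induction.\<close>

lemma cyc_pts_transfer:
  assumes D: "g ` D \<subseteq> D" and W: "cyc_pts D i g \<subseteq> W" and W': "W \<subseteq> D'"
    and eq: "\<And>y. y \<in> W \<Longrightarrow> g y = h y" and x: "x \<in> cyc_pts D i g" and i: "i > 0"
  shows "(g ^^ j) x = (h ^^ j) x" "x \<in> cyc_pts D' i h"
proof -
  have orb: "(g ^^ k) x \<in> cyc_pts D i g" for k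
  proof -
    let ?y = "(g ^^ k) x"
    have per: "(g ^^ i) x = x" using x by (simp add: cyc_pts_def)
    have "(g ^^ l) ?y \<noteq> ?y" if l: "0 < l" "l < i" for l
    proof
      assume a: "(g ^^ l) ?y = ?y"
      \<comment> \<open>\<open>m\<close> further steps complete \<open>k\<close> to a multiple of
        \<open>i\<close> and lead from \<open>?y\<close> back to \<open>x\<close>, so an early
        return of \<open>?y\<close> would give one of \<open>x\<close>.\<close>
      define m where "m = i * Suc k - k"
      have "k \<le> i * Suc k" using mult_le_mono[of 1 i k "Suc k"] i by simp
      then have m: "m + k = i * Suc k" by (simp add: m_def)
      have ret: "(g ^^ m) ?y = x"
      proof -
        have "(g ^^ m) ?y = (g ^^ (i * Suc k)) x" using m by (metis comp_apply funpow_add)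
        also have "\<dots> = (g ^^ (i * Suc k mod i)) x" by (subst funpow_mod_eq[OF per]) simp
        finally show ?thesis by simp
      qed
      have "(g ^^ l) x = x" using funpow_periodic_shift[OF a, of m] ret by simp
      with x l show False by (simp add: cyc_pts_def)
    qed
    then show ?thesis using funpow_periodic_shift[OF per] cyc_pts_orbit[OF x D]
      by (auto simp: cyc_pts_def)
  qed
  have eq': "(g ^^ k) x = (h ^^ k) x" for k
  proof (induction k)
    case (Suc k)
    have "(g ^^ k) x \<in> W" using orb W by blast
    with eq Suc show ?case by auto
  qed simp
  show "(g ^^ j) x = (h ^^ j) x" by (rule eq')
  show "x \<in> cyc_pts D' i h" using x eq' W W' by (auto simp: cyc_pts_def)
qed

lemma cycles_len_transfer:
  assumes D: "g ` D \<subseteq> D" "h ` D' \<subseteq> D'" and W: "cyc_pts D i g \<subseteq> W" "cyc_pts D' i h \<subseteq> W"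
    and WD: "W \<subseteq> D" "W \<subseteq> D'"
    and eq: "\<And>y. y \<in> W \<Longrightarrow> g y = h y" and i: "i > 0"
  shows "cycles_len D i g = cycles_len D' i h"
proof -
  note 1 = cyc_pts_transfer[OF D(1) W(1) WD(2) eq _ i]
  note 2 = cyc_pts_transfer[OF D(2) W(2) WD(1) eq[symmetric] _ i]
  have "cyc_pts D i g = cyc_pts D' i h" using 1(2) 2(2) by blast
  then show ?thesis unfolding cycles_len_def by (rule image_cong) (simp add: 2(1))
qed

text \<open>The bound of \<open>odd_cycle_near_origin\<close> depends on \<open>i\<close>,
  \<open>K\<close> and \<open>c\<close> but not on the window. Hence the \<open>i\<close>-cycles of
  the limit and of all windows lie in one finite set \<open>W\<close>, on which the patterns
  eventually agree with \<open>s\<close>.\<close>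

lemma tame_cycles:
  assumes s: "tame s" and i: "odd i"
  shows "cycle_count UNIV i (refl_about c \<circ> s) \<noteq> \<infinity>"
    and "eventually (\<lambda>n. cycle_count {c - int n..int n} i (refl_about c \<circ> pattern {c - int n..int n} s)
           = cycle_count UNIV i (refl_about c \<circ> s)) sequentially"
proof -
  have i0: "i > 0" using i by (rule odd_pos)
  obtain K where K: "\<And>a b y. y \<in> {a..b} \<Longrightarrow> \<bar>pattern {a..b} s y - y\<bar> \<le> int K + \<bar>y\<bar> div int i"
    "\<And>y. \<bar>s y - y\<bar> \<le> int K + \<bar>y\<bar> div int i" by (rule tame_displacement[OF s i0]) blast
  define W where "W = {- (int i * (int K + \<bar>c\<bar>))..int i * (int K + \<bar>c\<bar>)}"
  let ?g = "refl_about c \<circ> s"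
  have sub: "cyc_pts UNIV i ?g \<subseteq> W"
  proof
    fix x assume x: "x \<in> cyc_pts UNIV i ?g"
    have "\<bar>x\<bar> \<le> int i * (int K + \<bar>c\<bar>)" by (rule odd_cycle_near_origin[OF i K(2) _ x]) simp
    then show "x \<in> W" by (auto simp: W_def)
  qed
  have "finite W" by (simp add: W_def)
  with sub have "finite (cycles_len UNIV i ?g)"
    unfolding cycles_len_def using finite_subset by blast
  then show "cycle_count UNIV i ?g \<noteq> \<infinity>" by (simp add: cycle_count_def)
  have "eventually (\<lambda>n. \<forall>y\<in>W. pattern {c - int n..0 + int n} s y = s y) sequentially"
    by (intro eventually_ball_finite ballI \<open>finite W\<close> tame_eventually_pattern s)
  with eventually_interval_superset[OF \<open>finite W\<close>, of c 0]
  show "eventually (\<lambda>n. cycle_count {c - int n..int n} i (refl_about c \<circ> pattern {c - int n..int n} s)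
           = cycle_count UNIV i ?g) sequentially"
  proof eventually_elim
    case (elim n)
    let ?D = "{c - int n..int n}" and ?t = "pattern {c - int n..int n} s"
    have im: "(refl_about c \<circ> ?t) ` ?D \<subseteq> ?D"
    proof (rule image_subsetI)
      fix y assume "y \<in> ?D"
      from pattern_interval_in[OF this, of s] show "(refl_about c \<circ> ?t) y \<in> ?D"
        by (simp add: refl_about_def)
    qed
    have "cyc_pts ?D i (refl_about c \<circ> ?t) \<subseteq> W"
    proof
      fix x assume x: "x \<in> cyc_pts ?D i (refl_about c \<circ> ?t)"
      from odd_cycle_near_origin[OF i K(1) im x] show "x \<in> W" by (auto simp: W_def)
    qed
    with im sub elim have "cycles_len ?D i (refl_about c \<circ> ?t) = cycles_len UNIV i ?g"
      by (intro cycles_len_transfer[where W = W] i0) auto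
    then show ?case by (simp add: cycle_count_def)
  qed
qed

section \<open>Finite Mallows permutations\<close>

abbreviation perms :: "int set \<Rightarrow> (int \<Rightarrow> int) set" where "perms A \<equiv> {s. s permutes A}"

definition partition_fun :: "int set \<Rightarrow> real \<Rightarrow> real" where
  "partition_fun A q = (\<Sum>s\<in>perms A. q ^ inversions A s)"

lemma partition_fun_pos:
  assumes "finite A" "q > 0"
  shows "partition_fun A q > 0"
  unfolding partition_fun_def using assms
  by (intro sum_pos) (auto simp: finite_permutations intro!: exI[of _ id] permutes_id)

lemma pmf_mallows:
  assumes A: "finite A" and q: "q > 0"
  shows "pmf (mallows A q) s = (if s permutes A then q ^ inversions A s / partition_fun A q else 0)"
  unfolding mallows_def partition_fun_def[symmetric]
proof (rule pmf_embed_pmf)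
  let ?f = "\<lambda>s. if s permutes A then q ^ inversions A s / partition_fun A q else 0"
  have nn: "?f s \<ge> 0" for s using q partition_fun_pos[OF A q] by simp
  then show "0 \<le> ?f s" for s .
  have "(\<integral>\<^sup>+ s. ennreal (?f s) \<partial>count_space UNIV) = (\<Sum>s\<in>perms A. ennreal (?f s))"
    by (rule nn_integral_count_space') (auto simp: finite_permutations A)
  also have "\<dots> = ennreal (\<Sum>s\<in>perms A. ?f s)" using nn by (intro sum_ennreal)
  also have "(\<Sum>s\<in>perms A. ?f s) = 1"
    using partition_fun_pos[OF A q] by (simp add: sum_divide_distrib[symmetric] partition_fun_def)
  finally show "(\<integral>\<^sup>+ s. ennreal (?f s) \<partial>count_space UNIV) = 1" by simp
qed

lemma set_pmf_mallows:
  assumes "finite A" "q > 0"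
  shows "set_pmf (mallows A q) = perms A"
  using assms partition_fun_pos[OF assms] by (auto simp: set_pmf_eq pmf_mallows)

lemma expectation_mallows:
  fixes f :: "(int \<Rightarrow> int) \<Rightarrow> real"
  assumes "finite A" "q > 0"
  shows "measure_pmf.expectation (mallows A q) f
     = (\<Sum>s\<in>perms A. q ^ inversions A s * f s) / partition_fun A q"
proof -
  have "measure_pmf.expectation (mallows A q) f = (\<Sum>s\<in>perms A. f s * pmf (mallows A q) s)"
    by (rule integral_measure_pmf_real) (auto simp: set_pmf_mallows assms finite_permutations)
  then show ?thesis by (simp add: pmf_mallows assms sum_divide_distrib mult.commute)
qed

lemma prob_mallows:
  assumes "finite A" "q > 0"
  shows "measure_pmf.prob (mallows A q) X
     = (\<Sum>s\<in>{s\<in>perms A. s \<in> X}. q ^ inversions A s) / partition_fun A q"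
proof -
  have "measure_pmf.prob (mallows A q) X = measure_pmf.expectation (mallows A q) (indicator X)" by simp
  also have "\<dots> = (\<Sum>s\<in>perms A. q ^ inversions A s * indicator X s) / partition_fun A q"
    by (rule expectation_mallows[OF assms])
  also have "(\<Sum>s\<in>perms A. q ^ inversions A s * indicator X s) = (\<Sum>s\<in>{s\<in>perms A. s \<in> X}. q ^ inversions A s)"
    by (rule sum.mono_neutral_cong_right) (auto simp: finite_permutations assms)
  finally show ?thesis .
qed

text \<open>A common factor \<open>C\<close> between the weights cancels in the
  normalisation.\<close>

lemma map_mallows:
  assumes A: "finite A" and B: "finite B" and q: "q > 0" "q' > 0"
    and bij: "bij_betw F (perms A) (perms B)"
    and C: "\<And>s. s permutes A \<Longrightarrow> q ^ inversions A s = C * q' ^ inversions B (F s)"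
  shows "map_pmf F (mallows A q) = mallows B q'"
proof (rule pmf_eqI)
  fix t
  have Z: "partition_fun A q = C * partition_fun B q'"
    unfolding partition_fun_def sum_distrib_left
    using bij by (subst sum.reindex_bij_betw[OF bij, symmetric]) (simp add: C)
  have C0: "C \<noteq> 0" using Z partition_fun_pos[OF A q(1)] by auto
  show "pmf (map_pmf F (mallows A q)) t = pmf (mallows B q') t"
  proof (cases "t permutes B")
    case True
    then obtain s where s: "s permutes A" "t = F s" using bij by (auto simp: bij_betw_def)
    have "pmf (map_pmf F (mallows A q)) (F s) = pmf (mallows A q) s"
      using bij s by (intro pmf_map_inj) (auto simp: set_pmf_mallows A q bij_betw_def)
    also have "\<dots> = pmf (mallows B q') t"
      using True s C0 by (simp add: pmf_mallows A B q C Z)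
    finally show ?thesis using s by simp
  next
    case False
    then have "t \<notin> set_pmf (map_pmf F (mallows A q))"
      using bij by (auto simp: set_pmf_mallows A q bij_betw_def)
    then show ?thesis using False by (simp add: pmf_mallows B q pmf_eq_0_set_pmf)
  qed
qed

section \<open>Translation, rotation and reversal of finite Mallows permutations\<close>

lemma bij_betw_permsI:
  assumes "finite X" "inj_on F X" "F ` X \<subseteq> perms B" "finite B" "card X = fact (card B)"
  shows "bij_betw F X (perms B)"
proof -
  have "card (F ` X) = card (perms B)" using assms by (simp add: card_image card_permutations)
  then have "F ` X = perms B" using assms by (intro card_subset_eq finite_permutations) auto
  then show ?thesis using assms by (simp add: bij_betw_def)
qed

text \<open>Positions and values are moved separately, so that one construction covers conjugation
  by a translation or a reflection as well as the reversal of values.\<close>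

definition relabel :: "(int \<Rightarrow> int) \<Rightarrow> (int \<Rightarrow> int) \<Rightarrow> int set \<Rightarrow> (int \<Rightarrow> int) \<Rightarrow> int \<Rightarrow> int" where
  "relabel \<alpha> \<beta> B s x = (if x \<in> B then \<beta> (s (\<alpha> x)) else x)"

lemma relabel_permutes:
  assumes "bij_betw \<alpha> B A" "bij_betw \<beta> A B" "s permutes A"
  shows "relabel \<alpha> \<beta> B s permutes B"
proof (rule bij_imp_permutes)
  have "bij_betw (\<beta> \<circ> (s \<circ> \<alpha>)) B B"
    using assms permutes_imp_bij[OF assms(3)] by (intro bij_betw_trans)
  then show "bij_betw (relabel \<alpha> \<beta> B s) B B"
    by (subst bij_betw_cong[of _ _ "\<beta> \<circ> (s \<circ> \<alpha>)"]) (auto simp: relabel_def)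
qed (simp add: relabel_def)

lemma bij_betw_relabel:
  assumes A: "finite A" and \<alpha>: "bij_betw \<alpha> B A" and \<beta>: "bij_betw \<beta> A B"
  shows "bij_betw (relabel \<alpha> \<beta> B) (perms A) (perms B)"
proof (rule bij_betw_permsI)
  show "finite B" using A bij_betw_finite[OF \<alpha>] by simp
  show "finite (perms A)" using A by (rule finite_permutations)
  show "card (perms A) = fact (card B)" using A bij_betw_same_card[OF \<alpha>] by (simp add: card_permutations)
  show "relabel \<alpha> \<beta> B ` perms A \<subseteq> perms B" using relabel_permutes[OF \<alpha> \<beta>] by auto
  show "inj_on (relabel \<alpha> \<beta> B) (perms A)"
  proof (rule inj_onI, rule ext)
    fix s t y assume st: "s \<in> perms A" "t \<in> perms A" "relabel \<alpha> \<beta> B s = relabel \<alpha> \<beta> B t"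
    show "s y = t y"
    proof (cases "y \<in> A")
      case True
      then obtain x where x: "x \<in> B" "y = \<alpha> x" using \<alpha> by (auto simp: bij_betw_def)
      with fun_cong[OF st(3), of x] have "\<beta> (s y) = \<beta> (t y)" by (simp add: relabel_def)
      moreover have "s y \<in> A" "t y \<in> A" using True st by (auto simp: permutes_in_image)
      ultimately show ?thesis using \<beta> by (auto simp: bij_betw_def dest: inj_onD)
    next
      case False then show ?thesis using st by (simp add: permutes_not_in)
    qed
  qed
qed

lemma inversions_relabel_translate:
  "inversions ((\<lambda>x. x + t) ` B) s = inversions B (relabel (\<lambda>x. x + t) (\<lambda>x. x - t) B s)"
  unfolding inversions_def
  by (rule bij_betw_same_card[of "map_prod (\<lambda>x. x - t) (\<lambda>x. x - t)"],
      rule bij_betw_byWitness[where f' = "map_prod (\<lambda>x. x + t) (\<lambda>x. x + t)"])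
     (auto simp: relabel_def image_iff)

lemma mallows_translate:
  assumes "q > 0"
  shows "map_pmf (relabel (\<lambda>x. x + t) (\<lambda>x. x - t) {a..b}) (mallows {a + t..b + t} q) = mallows {a..b} q"
proof (rule map_mallows[where C = 1])
  have im: "(\<lambda>x. x + t) ` {a..b} = {a + t..b + t}"
    using image_add_atLeastAtMost'[of t a b] by simp
  show "bij_betw (relabel (\<lambda>x. x + t) (\<lambda>x. x - t) {a..b}) (perms {a + t..b + t}) (perms {a..b})"
    using im by (intro bij_betw_relabel) (auto simp: bij_betw_def inj_on_def image_iff)
  show "q ^ inversions {a + t..b + t} s
      = 1 * q ^ inversions {a..b} (relabel (\<lambda>x. x + t) (\<lambda>x. x - t) {a..b} s)" for s
    using inversions_relabel_translate[of t "{a..b}" s] by (simp add: im)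
qed (use assms in auto)

text \<open>A half turn of the diagram of \<open>s\<close> exchanges left with right and high with
  low, so an inversion \<open>(i, j)\<close> corresponds to the inversion
  \<open>(d - j, d - i)\<close>.\<close>

lemma inversions_relabel_reflect:
  "inversions ((\<lambda>x. d - x) ` B) s = inversions B (relabel (\<lambda>x. d - x) (\<lambda>x. d - x) B s)"
  unfolding inversions_def
  by (rule bij_betw_same_card[of "\<lambda>(i, j). (d - j, d - i)"],
      rule bij_betw_byWitness[where f' = "\<lambda>(i, j). (d - j, d - i)"])
     (auto simp: relabel_def image_iff)

lemma mallows_reflect:
  assumes "q > 0"
  shows "map_pmf (relabel (\<lambda>x. a + b - x) (\<lambda>x. a + b - x) {a..b}) (mallows {a..b} q) = mallows {a..b} q"
proof (rule map_mallows[where C = 1])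
  have im: "(\<lambda>x. a + b - x) ` {a..b} = {a..b}" by (auto intro!: image_eqI[where x = "a + b - x" for x])
  then show "bij_betw (relabel (\<lambda>x. a + b - x) (\<lambda>x. a + b - x) {a..b}) (perms {a..b}) (perms {a..b})"
    by (intro bij_betw_relabel) (auto simp: bij_betw_def inj_on_def)
  show "q ^ inversions {a..b} s
      = 1 * q ^ inversions {a..b} (relabel (\<lambda>x. a + b - x) (\<lambda>x. a + b - x) {a..b} s)" for s
    using inversions_relabel_reflect[of "a + b" "{a..b}" s] by (simp add: im)
qed (use assms in auto)

text \<open>Reversing the values turns inversions into non-inversions and conversely, so together
  the two counts exhaust all pairs.\<close>

lemma inversions_relabel_reverse:
  assumes B: "finite B" and s: "s permutes (\<lambda>x. x + t) ` B"
  shows "inversions ((\<lambda>x. x + t) ` B) s + inversions B (relabel (\<lambda>x. x + t) (\<lambda>x. d - x) B s)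
    = card {(i, j). i \<in> B \<and> j \<in> B \<and> i < j}"
proof -
  let ?u = "relabel (\<lambda>x. x + t) (\<lambda>x. d - x) B s"
  let ?I = "{(i, j). i \<in> B \<and> j \<in> B \<and> i < j \<and> ?u j > ?u i}"
  have "inversions ((\<lambda>x. x + t) ` B) s = card ?I"
    unfolding inversions_def
    by (rule bij_betw_same_card[of "map_prod (\<lambda>x. x - t) (\<lambda>x. x - t)"],
        rule bij_betw_byWitness[where f' = "map_prod (\<lambda>x. x + t) (\<lambda>x. x + t)"])
       (auto simp: relabel_def image_iff)
  moreover have "?u j > ?u i \<or> ?u i > ?u j" if "i \<in> B" "j \<in> B" "i < j" for i j
  proof -
    have "s (i + t) \<noteq> s (j + t)" using injD[OF permutes_inj[OF s], of "i + t" "j + t"] that by auto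
    then show ?thesis using that by (auto simp: relabel_def)
  qed
  then have "{(i, j). i \<in> B \<and> j \<in> B \<and> i < j} = ?I \<union> {(i, j). i \<in> B \<and> j \<in> B \<and> i < j \<and> ?u i > ?u j}"
    by blast
  moreover have "finite ?I" "finite {(i, j). i \<in> B \<and> j \<in> B \<and> i < j \<and> ?u i > ?u j}"
    using B by (auto intro: finite_subset[of _ "B \<times> B"])
  ultimately show ?thesis by (simp add: inversions_def card_Un_disjoint disjoint_iff)
qed

text \<open>Complementary inversion numbers turn weight \<open>q\<close> into weight
  \<open>1 / q\<close>, up to a constant factor which is \<open>q\<close> to the number of all
  pairs. This trades a parameter above 1 for one below 1.\<close>

lemma mallows_reverse:
  assumes "q > 0"
  shows "map_pmf (relabel (\<lambda>x. x + (1 - a)) (\<lambda>x. b + 1 - x) {a..b}) (mallows {1..b + 1 - a} q)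
     = mallows {a..b} (1 / q)"
proof (rule map_mallows)
  have im: "(\<lambda>x. x + (1 - a)) ` {a..b} = {1..b + 1 - a}"
    using image_add_atLeastAtMost'[of "1 - a" a b] by (simp add: algebra_simps)
  have im2: "(\<lambda>x. b + 1 - x) ` {1..b + 1 - a} = {a..b}"
    by (auto intro!: image_eqI[where x = "b + 1 - x" for x])
  show "bij_betw (relabel (\<lambda>x. x + (1 - a)) (\<lambda>x. b + 1 - x) {a..b}) (perms {1..b + 1 - a}) (perms {a..b})"
    using im im2 by (intro bij_betw_relabel) (auto simp: bij_betw_def inj_on_def)
  fix s assume "s permutes {1..b + 1 - a}"
  then have "inversions {1..b + 1 - a} s + inversions {a..b} (relabel (\<lambda>x. x + (1 - a)) (\<lambda>x. b + 1 - x) {a..b} s)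
     = card {(i, j). i \<in> {a..b} \<and> j \<in> {a..b} \<and> i < j}"
    using inversions_relabel_reverse[of "{a..b}" s "1 - a" "b + 1"] unfolding im by simp
  from this[symmetric] show "q ^ inversions {1..b + 1 - a} s
     = q ^ card {(i, j). i \<in> {a..b} \<and> j \<in> {a..b} \<and> i < j} *
       (1 / q) ^ inversions {a..b} (relabel (\<lambda>x. x + (1 - a)) (\<lambda>x. b + 1 - x) {a..b} s)"
    using assms by (simp add: power_add power_divide)
qed (use assms in auto)

section \<open>Growing a permutation by its last value\<close>

definition insert_last :: "int \<Rightarrow> int \<Rightarrow> (int \<Rightarrow> int) \<times> int \<Rightarrow> int \<Rightarrow> int" where
  "insert_last a b = (\<lambda>(s, v) x. if x \<in> {a..b} then (if v \<le> s x then s x + 1 else s x)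
      else if x = b + 1 then v else x)"

lemma insert_last_permutes:
  assumes s: "s permutes {a..b}" and v: "v \<in> {a..b + 1}"
  shows "insert_last a b (s, v) permutes {a..b + 1}"
proof (rule bij_imp_permutes)
  let ?f = "insert_last a b (s, v)"
  have sin: "s x \<in> {a..b}" if "x \<in> {a..b}" for x using that s by (simp only: permutes_in_image)
  have "inj_on ?f {a..b + 1}"
  proof (rule inj_onI)
    fix x y assume xy: "x \<in> {a..b + 1}" "y \<in> {a..b + 1}" "?f x = ?f y"
    show "x = y"
      using xy injD[OF permutes_inj[OF s], of x y]
      by (auto simp: insert_last_def split: if_splits)
  qed
  moreover have "?f ` {a..b + 1} \<subseteq> {a..b + 1}"
  proof (rule image_subsetI)
    fix x assume "x \<in> {a..b + 1}"
    then show "?f x \<in> {a..b + 1}" using sin[of x] v by (auto simp: insert_last_def)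
  qed
  ultimately show "bij_betw ?f {a..b + 1} {a..b + 1}"
    by (simp add: bij_betw_def endo_inj_surj)
  show "?f x = x" if "x \<notin> {a..b + 1}" for x using that v by (auto simp: insert_last_def)
qed

lemma bij_betw_insert_last:
  assumes "a \<le> b + 1"
  shows "bij_betw (insert_last a b) (perms {a..b} \<times> {a..b + 1}) (perms {a..b + 1})"
proof (rule bij_betw_permsI)
  show "inj_on (insert_last a b) (perms {a..b} \<times> {a..b + 1})"
  proof (rule inj_onI, clarify)
    fix s v t w
    assume st: "s permutes {a..b}" "t permutes {a..b}" and eq: "insert_last a b (s, v) = insert_last a b (t, w)"
    from fun_cong[OF eq, of "b + 1"] have vw: "v = w" by (simp add: insert_last_def)
    have "s x = t x" for x
    proof (cases "x \<in> {a..b}")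
      case True then show ?thesis using fun_cong[OF eq, of x] vw
        by (auto simp: insert_last_def split: if_splits)
    next
      case False
      from permutes_not_in[OF st(1) False] permutes_not_in[OF st(2) False] show ?thesis by simp
    qed
    with vw show "s = t \<and> v = w" by auto
  qed
  have "card {a..b + 1} = Suc (card {a..b})" using assms by simp
  then show "card (perms {a..b} \<times> {a..b + 1}) = fact (card {a..b + 1})"
    by (simp only: card_cartesian_product card_permutations[OF refl finite_atLeastAtMost_int] fact_Suc)
       simp
qed (auto simp: finite_permutations insert_last_permutes)

text \<open>Insertion preserves the order of the old values, so each new inversion pairs the new
  position with an old value that is at least \<open>v\<close>. As \<open>s\<close> permutes
  \<open>{a..b}\<close>, there are \<open>b + 1 - v\<close> of these.\<close>

lemma inversions_insert_last:
  assumes s: "s permutes {a..b}" and v: "v \<in> {a..b + 1}"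
  shows "inversions {a..b + 1} (insert_last a b (s, v)) = inversions {a..b} s + nat (b + 1 - v)"
proof -
  let ?f = "insert_last a b (s, v)"
  let ?I = "{(i, j). i \<in> {a..b} \<and> j \<in> {a..b} \<and> i < j \<and> s i > s j}"
  let ?X = "{x \<in> {a..b}. v \<le> s x}"
  have "{(i, j). i \<in> {a..b + 1} \<and> j \<in> {a..b + 1} \<and> i < j \<and> ?f i > ?f j} = ?I \<union> (\<lambda>x. (x, b + 1)) ` ?X"
  proof (rule set_eqI)
    fix ij :: "int \<times> int"
    obtain i j where ij: "ij = (i, j)" by (cases ij)
    have "i \<in> {a..b + 1} \<and> j \<in> {a..b + 1} \<and> i < j \<and> ?f i > ?f j
      \<longleftrightarrow> i \<in> {a..b} \<and> j \<in> {a..b} \<and> i < j \<and> s i > s j \<or> j = b + 1 \<and> i \<in> {a..b} \<and> v \<le> s i"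
    proof (cases "j = b + 1")
      case True
      then show ?thesis by (auto simp: insert_last_def)
    next
      case False
      then have "i \<in> {a..b + 1} \<and> j \<in> {a..b + 1} \<and> i < j \<longleftrightarrow> i \<in> {a..b} \<and> j \<in> {a..b} \<and> i < j"
        by auto
      moreover have "?f i > ?f j \<longleftrightarrow> s i > s j" if "i \<in> {a..b}" "j \<in> {a..b}"
        using that by (auto simp: insert_last_def)
      ultimately show ?thesis using False by blast
    qed
    then show "ij \<in> {(i, j). i \<in> {a..b + 1} \<and> j \<in> {a..b + 1} \<and> i < j \<and> ?f i > ?f j}
      \<longleftrightarrow> ij \<in> ?I \<union> (\<lambda>x. (x, b + 1)) ` ?X" unfolding ij by blast
  qed
  moreover have "card (?I \<union> (\<lambda>x. (x, b + 1)) ` ?X) = card ?I + card ((\<lambda>x. (x, b + 1)) ` ?X)"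
    by (rule card_Un_disjoint)
       (auto intro!: finite_imageI intro: finite_subset[of _ "{a..b} \<times> {a..b}"] finite_subset[of _ "{a..b}"])
  moreover have "card ((\<lambda>x. (x, b + 1)) ` ?X) = card ?X" by (rule card_image) (auto simp: inj_on_def)
  moreover have "card ?X = card (s ` ?X)" by (rule card_image[symmetric]) (rule permutes_inj_on[OF s])
  moreover have "s ` ?X = {v..b}"
  proof (rule equalityI)
    show "s ` ?X \<subseteq> {v..b}"
    proof (rule image_subsetI)
      fix x assume "x \<in> ?X"
      then show "s x \<in> {v..b}" using permutes_in_image[OF s, of x] by simp
    qed
    show "{v..b} \<subseteq> s ` ?X"
    proof
      fix z assume z: "z \<in> {v..b}"
      then have "z \<in> s ` {a..b}" using v by (simp add: permutes_image[OF s])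
      with z show "z \<in> s ` ?X" by auto
    qed
  qed
  ultimately show ?thesis by (simp add: inversions_def)
qed

text \<open>The weight factorises along the insertion: under the Mallows law the pattern of the
  earlier entries is independent of the last value, whose distance from the top is a truncated
  geometric variable.\<close>

lemma sum_perms_insert_last:
  fixes q :: real
  assumes "a \<le> b + 1"
  shows "(\<Sum>s\<in>perms {a..b + 1}. q ^ inversions {a..b + 1} s * g s)
    = (\<Sum>s\<in>perms {a..b}. q ^ inversions {a..b} s *
         (\<Sum>v\<in>{a..b + 1}. q ^ nat (b + 1 - v) * g (insert_last a b (s, v))))"
proof -
  have "(\<Sum>s\<in>perms {a..b + 1}. q ^ inversions {a..b + 1} s * g s)
      = (\<Sum>x\<in>perms {a..b} \<times> {a..b + 1}. q ^ inversions {a..b + 1} (insert_last a b x) * g (insert_last a b x))"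
    by (rule sum.reindex_bij_betw[OF bij_betw_insert_last[OF assms], symmetric])
  also have "\<dots> = (\<Sum>(s, v)\<in>perms {a..b} \<times> {a..b + 1}.
      q ^ inversions {a..b} s * (q ^ nat (b + 1 - v) * g (insert_last a b (s, v))))"
  proof (rule sum.cong[OF refl])
    fix x assume "x \<in> perms {a..b} \<times> {a..b + 1}"
    then obtain s v where "x = (s, v)" "s permutes {a..b}" "v \<in> {a..b + 1}" by auto
    then show "q ^ inversions {a..b + 1} (insert_last a b x) * g (insert_last a b x)
      = (case x of (s, v) \<Rightarrow> q ^ inversions {a..b} s * (q ^ nat (b + 1 - v) * g (insert_last a b (s, v))))"
      by (simp only: inversions_insert_last power_add prod.case mult.assoc)
  qed
  finally show ?thesis by (simp only: sum.cartesian_product[symmetric] sum_distrib_left)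
qed

lemma power_lt_one:
  fixes q :: real
  assumes "0 < q" "q < 1" "0 < n"
  shows "q ^ n < 1"
  using power_strict_decreasing[of 0 n q] assms by simp

lemma sum_geometric_interval:
  fixes q :: real
  assumes "q \<noteq> 1" "x \<le> b"
  shows "(\<Sum>v\<in>{x + 1..b}. q ^ nat (b - v)) = (1 - q ^ nat (b - x)) / (1 - q)"
proof -
  have "(\<Sum>v\<in>{x + 1..b}. q ^ nat (b - v)) = (\<Sum>k<nat (b - x). q ^ k)"
    by (rule sum.reindex_bij_witness[where i = "\<lambda>k. b - int k" and j = "\<lambda>v. nat (b - v)"]) auto
  then show ?thesis using assms by (simp add: sum_gp_strict)
qed

lemma partition_fun_insert_last:
  assumes "q \<noteq> 1" "a \<le> b + 1"
  shows "partition_fun {a..b + 1} q = partition_fun {a..b} q * ((1 - q ^ nat (b + 2 - a)) / (1 - q))"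
  using sum_perms_insert_last[OF assms(2), of q "\<lambda>_. 1"] sum_geometric_interval[OF assms(1), of "a - 1" "b + 1"] assms
  by (simp add: partition_fun_def sum_distrib_right[symmetric] algebra_simps)

text \<open>By the insertion recursion the last value lies \<open>r\<close> below the top with
  weight \<open>q ^ r\<close>, whatever the other entries are, so only truncated geometric sums have
  to be compared.\<close>

lemma mallows_last_tail:
  fixes q :: real
  assumes q: "0 < q" "q < 1" and ab: "a \<le> b"
  shows "measure_pmf.prob (mallows {a..b} q) {s. int m \<le> b - s b} \<le> q ^ m"
proof -
  let ?w = "\<lambda>s. q ^ inversions {a..b - 1} s" and ?g = "\<lambda>v. q ^ nat (b - v)"
  let ?W = "\<Sum>s\<in>perms {a..b - 1}. ?w s"
  have W: "?W \<ge> 0" using q by (intro sum_nonneg) auto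
  have Z: "partition_fun {a..b} q = ?W * (\<Sum>v\<in>{a..b}. ?g v)"
    using sum_perms_insert_last[of a "b - 1" q "\<lambda>_. 1"] ab
    by (simp add: partition_fun_def sum_distrib_right)
  have "(\<Sum>s\<in>{s \<in> perms {a..b}. s \<in> {s. int m \<le> b - s b}}. q ^ inversions {a..b} s)
      = (\<Sum>s\<in>perms {a..b}. q ^ inversions {a..b} s * of_bool (int m \<le> b - s b))"
    by (rule sum.mono_neutral_cong_left) (auto simp: finite_permutations)
  also have "\<dots> = (\<Sum>s\<in>perms {a..b - 1}. ?w s * (\<Sum>v\<in>{a..b}. ?g v * of_bool (int m \<le> b - v)))"
    using sum_perms_insert_last[of a "b - 1" q "\<lambda>s. of_bool (int m \<le> b - s b)"] ab
    by (simp add: insert_last_def)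
  also have "\<dots> = ?W * (\<Sum>v\<in>{a..b}. ?g v * of_bool (int m \<le> b - v))"
    by (simp add: sum_distrib_right)
  also have "(\<Sum>v\<in>{a..b}. ?g v * of_bool (int m \<le> b - v)) = (\<Sum>v\<in>{a..b - int m}. ?g v)"
    by (rule sum.mono_neutral_cong_right) auto
  \<comment> \<open>Shifting \<open>v\<close> by \<open>m\<close> extracts \<open>q ^ m\<close>;
    filling the range up to \<open>{a..b}\<close> again then gives an upper bound by the full
    sum.\<close>
  also have "\<dots> = (\<Sum>v\<in>{a + int m..b}. q ^ m * ?g v)"
    by (rule sum.reindex_bij_witness[where i = "\<lambda>v. v - int m" and j = "\<lambda>v. v + int m"])
       (auto simp: power_add[symmetric] nat_add_distrib[symmetric] intro!: arg_cong[where f = "power q"])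
  also have "\<dots> \<le> (\<Sum>v\<in>{a..b}. q ^ m * ?g v)"
    using q by (intro sum_mono2) auto
  also have "\<dots> = q ^ m * (\<Sum>v\<in>{a..b}. ?g v)" by (simp add: sum_distrib_left)
  finally have "(\<Sum>s\<in>{s \<in> perms {a..b}. s \<in> {s. int m \<le> b - s b}}. q ^ inversions {a..b} s)
      \<le> ?W * (q ^ m * (\<Sum>v\<in>{a..b}. ?g v))"
    using W by (simp add: mult_left_mono)
  also have "\<dots> = q ^ m * partition_fun {a..b} q" unfolding Z by simp
  finally have "(\<Sum>s\<in>{s \<in> perms {a..b}. s \<in> {s. int m \<le> b - s b}}. q ^ inversions {a..b} s)
      \<le> q ^ m * partition_fun {a..b} q" .
  then show ?thesis using partition_fun_pos[of "{a..b}" q] q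
    by (subst prob_mallows) (simp_all add: divide_le_eq)
qed

lemma mallows_first_tail:
  assumes q: "0 < q" "q < 1" and ab: "a \<le> b"
  shows "measure_pmf.prob (mallows {a..b} q) {s. int m \<le> s a - a} \<le> q ^ m"
proof -
  have "measure_pmf.prob (mallows {a..b} q) {s. int m \<le> s a - a}
      = measure_pmf.prob (map_pmf (relabel (\<lambda>x. a + b - x) (\<lambda>x. a + b - x) {a..b}) (mallows {a..b} q))
          {s. int m \<le> s a - a}"
    by (simp add: mallows_reflect q)
  also have "\<dots> = measure_pmf.prob (mallows {a..b} q) {s. int m \<le> b - s b}"
    using ab by (simp add: relabel_def vimage_def)
  also have "\<dots> \<le> q ^ m" by (rule mallows_last_tail[OF q ab])
  finally show ?thesis .
qed

section \<open>The weighted sign of the value at the origin\<close>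

definition parity_sign :: "int \<Rightarrow> real" where "parity_sign x = (if even x then 1 else - 1)"

lemma parity_sign_add1: "parity_sign (x + 1) = - parity_sign x"
  by (simp add: parity_sign_def)

text \<open>In q-Pochhammer notation this is \<open>(-q; q)_u / (q; q)_u\<close>. The recurrence
  \<open>(1 - q ^ Suc u) * qratio q (Suc u) = (1 + q ^ Suc u) * qratio q u\<close> is what makes the
  sums below collapse.\<close>

definition qratio :: "real \<Rightarrow> nat \<Rightarrow> real" where
  "qratio q u = (\<Prod>t=1..u. (1 + q ^ t) / (1 - q ^ t))"

lemma qratio_Suc: "qratio q (Suc u) = qratio q u * ((1 + q ^ Suc u) / (1 - q ^ Suc u))"
  by (simp add: qratio_def prod.nat_ivl_Suc')

definition signed_mean :: "real \<Rightarrow> int \<Rightarrow> int \<Rightarrow> real" where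
  "signed_mean q a b = measure_pmf.expectation (mallows {a..b} q)
     (\<lambda>s. parity_sign (s 0) * qratio q (nat (b - s 0)))"

text \<open>The weights \<open>qratio\<close> are chosen so that averaging over the rank of the inserted last element
  multiplies the signed mean by a factor not depending on the permutation.\<close>
lemma signed_mean_insert_last:
  assumes q: "0 < q" "q < 1" and ab: "a \<le> 0" "0 \<le> b"
  shows "signed_mean q a (b + 1)
     = signed_mean q a b * ((1 + q ^ nat (b + 2 - a)) / (1 - q ^ nat (b + 2 - a)))"
proof -
  let ?n = "nat (b + 2 - a)"
  let ?f = "\<lambda>b s. parity_sign (s 0) * qratio q (nat (b - s 0))"
  have qn: "q ^ ?n < 1" using q ab by (intro power_lt_one) auto
  have inner: "(\<Sum>v\<in>{a..b + 1}. q ^ nat (b + 1 - v) * ?f (b + 1) (insert_last a b (s, v)))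
      = (1 + q ^ ?n) / (1 - q) * ?f b s" if s: "s permutes {a..b}" for s
  proof -
    define x where "x = s 0"
    have x: "x \<in> {a..b}" unfolding x_def using permutes_in_image[OF s, of 0] ab by auto
    define u where "u = nat (b - x)"
    have qu: "q ^ Suc u < 1" using q by (intro power_lt_one) auto
    let ?g = "\<lambda>v. q ^ nat (b + 1 - v)"
    have nat1: "nat (b + 1 - x) = Suc u" and nat2: "nat (b + 1 - (x + 1)) = u"
      using x by (auto simp: u_def)
    have S1: "(\<Sum>v\<in>{x + 1..b + 1}. ?g v) = (1 - q ^ Suc u) / (1 - q)"
      using sum_geometric_interval[of q x "b + 1"] q x by (simp add: nat1)
    have S0: "(\<Sum>v\<in>{a..b + 1}. ?g v) = (1 - q ^ ?n) / (1 - q)"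
      using sum_geometric_interval[of q "a - 1" "b + 1"] q ab by (simp add: algebra_simps)
    have split: "{a..b + 1} = {a..x} \<union> {x + 1..b + 1}" using x by auto
    have "(\<Sum>v\<in>{a..x}. ?g v) + (\<Sum>v\<in>{x + 1..b + 1}. ?g v) = (\<Sum>v\<in>{a..b + 1}. ?g v)"
      unfolding split by (rule sum.union_disjoint[symmetric]) auto
    with S0 S1 have S2: "(\<Sum>v\<in>{a..x}. ?g v) = (q ^ Suc u - q ^ ?n) / (1 - q)"
      by (simp add: diff_divide_distrib)
    \<comment> \<open>An inserted \<open>v \<le> x\<close> raises the value at \<open>0\<close> to
      \<open>x + 1\<close>, which flips the sign and keeps \<open>u\<close>; a larger
      \<open>v\<close> keeps the value and raises \<open>u\<close> by one.\<close>
    have "(\<Sum>v\<in>{a..b + 1}. ?g v * ?f (b + 1) (insert_last a b (s, v)))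
        = (\<Sum>v\<in>{a..x}. ?g v * ?f (b + 1) (insert_last a b (s, v)))
        + (\<Sum>v\<in>{x + 1..b + 1}. ?g v * ?f (b + 1) (insert_last a b (s, v)))"
      unfolding split by (rule sum.union_disjoint) auto
    also have "(\<Sum>v\<in>{a..x}. ?g v * ?f (b + 1) (insert_last a b (s, v)))
        = (\<Sum>v\<in>{a..x}. ?g v * (- (parity_sign x * qratio q u)))"
      using ab nat2 by (intro sum.cong) (auto simp: insert_last_def parity_sign_add1 x_def[symmetric])
    also have "(\<Sum>v\<in>{x + 1..b + 1}. ?g v * ?f (b + 1) (insert_last a b (s, v)))
        = (\<Sum>v\<in>{x + 1..b + 1}. ?g v * (parity_sign x * qratio q (Suc u)))"
      using ab nat1 by (intro sum.cong) (auto simp: insert_last_def x_def[symmetric])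
    finally have "(\<Sum>v\<in>{a..b + 1}. ?g v * ?f (b + 1) (insert_last a b (s, v)))
        = (q ^ Suc u - q ^ ?n) / (1 - q) * (- (parity_sign x * qratio q u))
        + (1 - q ^ Suc u) / (1 - q) * (parity_sign x * qratio q (Suc u))"
      by (simp only: sum_distrib_right[symmetric] S1 S2)
    \<comment> \<open>After applying the recurrence of \<open>qratio\<close> to the last term, the
      powers \<open>q ^ Suc u\<close> cancel, which frees the factor from \<open>s\<close>.\<close>
    also have "\<dots> = (1 + q ^ ?n) / (1 - q) * (parity_sign x * qratio q u)"
      using qu q unfolding qratio_Suc by (simp add: divide_simps) (simp add: algebra_simps)
    finally show ?thesis by (simp add: x_def u_def)
  qed
  have "(\<Sum>s\<in>perms {a..b + 1}. q ^ inversions {a..b + 1} s * ?f (b + 1) s)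
      = (\<Sum>s\<in>perms {a..b}. q ^ inversions {a..b} s * ((1 + q ^ ?n) / (1 - q) * ?f b s))"
    using ab inner by (subst sum_perms_insert_last) (auto intro!: sum.cong)
  also have "\<dots> = (1 + q ^ ?n) / (1 - q) * (\<Sum>s\<in>perms {a..b}. q ^ inversions {a..b} s * ?f b s)"
    by (simp add: sum_distrib_left algebra_simps)
  finally show ?thesis
    unfolding signed_mean_def expectation_mallows[OF finite_atLeastAtMost_int q(1)]
    using partition_fun_insert_last[of q a b] q ab by simp
qed

text \<open>Here \<open>0\<close> is the last position: its value \<open>- r\<close> has weight
  \<open>q ^ r\<close> and sign \<open>(-1) ^ r\<close>, with \<open>r\<close> values above it. This
  produces a partial sum of the power series of \<open>qratio\<close> at \<open>- q\<close>.\<close>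

lemma signed_mean_zero:
  assumes q: "0 < q" "q < 1"
  shows "signed_mean q (- int n) 0 = (1 - q) / (1 - q ^ Suc n) * (\<Sum>r\<le>n. (- q) ^ r * qratio q r)"
proof -
  let ?f = "\<lambda>s. parity_sign (s 0) * qratio q (nat (0 - s 0))"
  have "(\<Sum>s\<in>perms {- int n..0}. q ^ inversions {- int n..0} s * ?f s)
      = (\<Sum>s\<in>perms {- int n..-1}. q ^ inversions {- int n..-1} s
          * (\<Sum>v\<in>{- int n..0}. q ^ nat (- v) * (parity_sign v * qratio q (nat (- v)))))"
    using sum_perms_insert_last[of "- int n" "-1" q ?f] by (simp add: insert_last_def)
  also have "(\<Sum>v\<in>{- int n..0}. q ^ nat (- v) * (parity_sign v * qratio q (nat (- v))))
      = (\<Sum>r\<le>n. (- q) ^ r * qratio q r)"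
    by (rule sum.reindex_bij_witness[where i = "\<lambda>r. - int r" and j = "\<lambda>v. nat (- v)"])
       (auto simp: power_minus[of q] parity_sign_def even_nat_iff)
  finally have "(\<Sum>s\<in>perms {- int n..0}. q ^ inversions {- int n..0} s * ?f s)
      = partition_fun {- int n..-1} q * (\<Sum>r\<le>n. (- q) ^ r * qratio q r)"
    by (simp add: partition_fun_def sum_distrib_right)
  moreover have "partition_fun {- int n..0} q = partition_fun {- int n..-1} q * ((1 - q ^ Suc n) / (1 - q))"
    using partition_fun_insert_last[of q "- int n" "-1"] q by (simp add: nat_add_distrib del: power_Suc)
  moreover have "q ^ Suc n < 1" using q by (intro power_lt_one) auto
  ultimately show ?thesis
    unfolding signed_mean_def expectation_mallows[OF finite_atLeastAtMost_int q(1)]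
    using partition_fun_pos[of "{- int n..-1}" q] q by (simp del: power_Suc)
qed

lemma qratio_pos:
  assumes q: "0 < q" "q < 1"
  shows "qratio q u > 0"
  unfolding qratio_def
proof (rule prod_pos)
  fix t assume "t \<in> {1..u}"
  then have "q ^ t < 1" using q by (intro power_lt_one) auto
  then show "0 < (1 + q ^ t) / (1 - q ^ t)" using q by (simp add: add_pos_pos)
qed

text \<open>Extending the window step by step from \<open>b = 0\<close> contributes the factors of
  \<open>qratio\<close> with indices from \<open>n + 2\<close> to \<open>n + k + 1\<close>, whose
  product is the quotient.\<close>

lemma signed_mean_symmetric:
  assumes q: "0 < q" "q < 1"
  shows "signed_mean q (- int n) (int k) = signed_mean q (- int n) 0 * (qratio q (Suc (n + k)) / qratio q (Suc n))"
proof (induction k)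
  case 0 then show ?case using qratio_pos[OF q, of "Suc n"] by simp
next
  case (Suc k)
  define w where "w = (1 + q ^ Suc (n + Suc k)) / (1 - q ^ Suc (n + Suc k))"
  have "nat (int k + 2 - - int n) = Suc (n + Suc k)" by simp
  with signed_mean_insert_last[OF q, of "- int n" "int k"]
  have "signed_mean q (- int n) (int (Suc k)) = signed_mean q (- int n) (int k) * w"
    by (simp add: w_def add.commute del: power_Suc)
  moreover have "qratio q (Suc (n + Suc k)) = qratio q (Suc (n + k)) * w"
    by (simp only: w_def qratio_Suc[of q "n + Suc k"]) simp
  ultimately show ?case using Suc by simp
qed

section \<open>Limit of the weights and positivity of their power series\<close>

lemma qratio_mono:
  assumes q: "0 < q" "q < 1"
  shows "incseq (qratio q)"
proof (rule incseq_SucI)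
  fix n
  have "q ^ Suc n < 1" using q by (intro power_lt_one) auto
  then have "1 \<le> (1 + q ^ Suc n) / (1 - q ^ Suc n)" using q by (simp add: divide_simps)
  then show "qratio q n \<le> qratio q (Suc n)" 
    using qratio_pos[OF q, of n] mult_left_mono[of 1 _ "qratio q n"] by (simp only: qratio_Suc less_imp_le mult_1_right)
qed

text \<open>For \<open>0 < x \<le> q\<close> one has \<open>(1 + x) / (1 - x) = 1 + 2 * x / (1 - x)
  \<le> exp (2 * x / (1 - q))\<close>; adding the exponents for \<open>x = q ^ t\<close> gives a
  bound independent of \<open>u\<close>.\<close>

lemma qratio_le:
  assumes q: "0 < q" "q < 1"
  shows "qratio q u \<le> exp (2 * q / (1 - q)\<^sup>2)"
proof -
  have "qratio q u \<le> (\<Prod>t=1..u. exp (2 * q ^ t / (1 - q)))"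
    unfolding qratio_def
  proof (rule prod_mono)
    fix t assume "t \<in> {1..u}"
    then have t: "q ^ t \<le> q" using q power_decreasing[of 1 t q] by simp
    then have "(1 + q ^ t) / (1 - q ^ t) = 1 + 2 * q ^ t / (1 - q ^ t)" using q by (simp add: field_simps)
    also have "\<dots> \<le> 1 + 2 * q ^ t / (1 - q)" using q t by (intro add_left_mono divide_left_mono) auto
    also have "\<dots> \<le> exp (2 * q ^ t / (1 - q))" by (rule exp_ge_add_one_self)
    finally show "0 \<le> (1 + q ^ t) / (1 - q ^ t) \<and> (1 + q ^ t) / (1 - q ^ t) \<le> exp (2 * q ^ t / (1 - q))"
      using q t by (auto intro!: divide_nonneg_pos add_nonneg_nonneg)
  qed
  also have "\<dots> = exp (\<Sum>t=1..u. 2 * q ^ t / (1 - q))" by (simp add: exp_sum)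
  also have "(\<Sum>t=1..u. 2 * q ^ t / (1 - q)) = 2 / (1 - q) * (\<Sum>t=1..u. q ^ t)"
    by (simp add: sum_distrib_left)
  also have "exp (2 / (1 - q) * (\<Sum>t=1..u. q ^ t)) \<le> exp (2 / (1 - q) * (q / (1 - q)))"
  proof -
    have "(\<Sum>t=1..u. q ^ t) = q * (\<Sum>t<u. q ^ t)"
      by (simp add: sum_distrib_left sum.atLeast1_atMost_eq)
    also have "(\<Sum>t<u. q ^ t) \<le> 1 / (1 - q)" using q by (simp add: sum_gp_strict divide_right_mono)
    finally have "(\<Sum>t=1..u. q ^ t) \<le> q * (1 / (1 - q))" using q by (simp add: mult_left_mono)
    then have "2 / (1 - q) * (\<Sum>t=1..u. q ^ t) \<le> 2 / (1 - q) * (q / (1 - q))"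
      using q by (intro mult_left_mono) auto
    then show ?thesis by simp
  qed
  finally show ?thesis by (simp add: power2_eq_square)
qed

text \<open>By the q-binomial theorem this is
  \<open>(- q z; q)_\<infinity> / (z; q)_\<infinity>\<close>. Its sign at \<open>- q\<close> is
  found below from the functional equation and continuity at \<open>0\<close>.\<close>

definition qratio_series :: "real \<Rightarrow> real \<Rightarrow> real" where
  "qratio_series q z = (\<Sum>r. qratio q r * z ^ r)"

lemma summable_qratio_series:
  assumes q: "0 < q" "q < 1" and z: "\<bar>z\<bar> < 1"
  shows "summable (\<lambda>r. qratio q r * z ^ r)"
proof (rule summable_comparison_test')
  show "summable (\<lambda>r. exp (2 * q / (1 - q)\<^sup>2) * \<bar>z\<bar> ^ r)"
    using z by (intro summable_mult summable_geometric) auto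
  fix r :: nat
  show "norm (qratio q r * z ^ r) \<le> exp (2 * q / (1 - q)\<^sup>2) * \<bar>z\<bar> ^ r"
    using qratio_le[OF q, of r] qratio_pos[OF q, of r]
    by (auto simp: abs_mult power_abs intro!: mult_right_mono)
qed

text \<open>The difference of the series at \<open>z\<close> and at \<open>q * z\<close> has
  coefficients with the factor \<open>1 - q ^ r\<close>, which the recurrence of
  \<open>qratio\<close> turns into terms of index \<open>r - 1\<close>.\<close>

lemma qratio_series_functional_eq:
  assumes q: "0 < q" "q < 1" and z: "\<bar>z\<bar> < 1"
  shows "(1 - z) * qratio_series q z = (1 + q * z) * qratio_series q (q * z)"
proof -
  have qz: "\<bar>q * z\<bar> < 1" 
  proof -
    have "q * \<bar>z\<bar> \<le> 1 * \<bar>z\<bar>" using q by (intro mult_right_mono) auto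
    then show ?thesis using q z by (simp add: abs_mult)
  qed
  note S = summable_qratio_series[OF q z] summable_qratio_series[OF q qz]
  let ?d = "\<lambda>r. qratio q r * z ^ r - qratio q r * (q * z) ^ r"
  have "(\<lambda>r. ?d (Suc r)) = (\<lambda>r. z * (qratio q r * z ^ r) + q * z * (qratio q r * (q * z) ^ r))"
  proof
    fix r
    have qr: "q ^ Suc r < 1" using q by (intro power_lt_one) auto
    have "?d (Suc r) = qratio q (Suc r) * (1 - q ^ Suc r) * z ^ Suc r"
      by (simp add: algebra_simps power_mult_distrib)
    also have "qratio q (Suc r) * (1 - q ^ Suc r) = qratio q r * (1 + q ^ Suc r)"
      unfolding qratio_Suc using qr by simp
    finally show "?d (Suc r) = z * (qratio q r * z ^ r) + q * z * (qratio q r * (q * z) ^ r)"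
      by (simp add: algebra_simps power_mult_distrib)
  qed
  moreover have "(\<lambda>r. z * (qratio q r * z ^ r) + q * z * (qratio q r * (q * z) ^ r))
      sums (z * qratio_series q z + q * z * qratio_series q (q * z))"
    unfolding qratio_series_def by (intro sums_add sums_mult summable_sums S)
  ultimately have "(\<lambda>r. ?d (Suc r)) sums (z * qratio_series q z + q * z * qratio_series q (q * z))"
    by (simp only:)
  \<comment> \<open>The term of index 0 of \<open>?d\<close> vanishes, so shifting the index does
    not change the sum.\<close>
  then have "?d sums (z * qratio_series q z + q * z * qratio_series q (q * z))"
    using sums_Suc_iff[of ?d] by simp
  moreover have "?d sums (qratio_series q z - qratio_series q (q * z))"
    unfolding qratio_series_def by (intro sums_diff summable_sums S)
  ultimately have "z * qratio_series q z + q * z * qratio_series q (q * z)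
      = qratio_series q z - qratio_series q (q * z)" by (rule sums_unique2)
  then show ?thesis by (simp add: algebra_simps)
qed

text \<open>Between -1 and 0 both factors of the functional equation are positive, so a nonpositive
  value at \<open>- q\<close> would pass to every \<open>- (q ^ Suc n)\<close>. These points tend to
  \<open>0\<close>, where the series equals 1.\<close>

lemma qratio_series_pos:
  assumes q: "0 < q" "q < 1"
  shows "qratio_series q (- q) > 0"
proof (rule ccontr)
  assume nonpos: "\<not> ?thesis"
  have qn: "q ^ Suc n < 1" for n using q by (intro power_lt_one) auto
  have neg: "qratio_series q (- (q ^ Suc n)) \<le> 0" for n
  proof (induction n)
    case 0 then show ?case using nonpos by simp
  next
    case (Suc n)
    let ?z = "- (q ^ Suc n)"
    have "(1 - ?z) * qratio_series q ?z = (1 + q * ?z) * qratio_series q (q * ?z)"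
      using qn[of n] q by (intro qratio_series_functional_eq) auto
    moreover have "(1 - ?z) * qratio_series q ?z \<le> 0" using Suc q by (intro mult_nonneg_nonpos) auto
    moreover have "1 + q * ?z > 0" using qn[of "Suc n"] by simp
    ultimately show ?case by (simp add: mult_le_0_iff)
  qed
  have "isCont (qratio_series q) 0"
    unfolding qratio_series_def using q
    by (intro isCont_powser[where K = "1/2"] summable_qratio_series) auto
  moreover have "(\<lambda>n. - (q ^ Suc n)) \<longlonglongrightarrow> - 0"
    using q by (intro tendsto_minus LIMSEQ_Suc LIMSEQ_power_zero) auto
  ultimately have "(\<lambda>n. qratio_series q (- (q ^ Suc n))) \<longlonglongrightarrow> qratio_series q 0"
    unfolding minus_zero by (rule isCont_tendsto_compose)
  then have "qratio_series q 0 \<le> 0" by (rule LIMSEQ_le_const2) (use neg in auto)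
  moreover have "qratio_series q 0 = 1"
    unfolding qratio_series_def using powser_zero[of "qratio q"] by (simp add: qratio_def)
  ultimately show False by simp
qed

lemma qratio_limit:
  assumes q: "0 < q" "q < 1"
  obtains C where "qratio q \<longlonglongrightarrow> C" "C > 0" "\<And>u. qratio q u \<le> C"
proof -
  have "convergent (qratio q)"
    using qratio_mono[OF q] qratio_le[OF q] by (intro Bseq_monoseq_convergent BseqI')
      (auto simp: incseq_def monoseq_def abs_of_pos[OF qratio_pos[OF q]])
  then obtain C where C: "qratio q \<longlonglongrightarrow> C" by (auto simp: convergent_def)
  have le: "qratio q u \<le> C" for u by (rule incseq_le[OF qratio_mono[OF q] C])
  with qratio_pos[OF q, of 0] have "C > 0" using less_le_trans by blast
  with C le that show thesis by blast
qed

text \<open>The quotient in \<open>signed_mean_symmetric\<close> tends to 1, as both weights have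
  the same positive limit, so the limit is that of the expression in
  \<open>signed_mean_zero\<close>.\<close>

lemma signed_mean_limit:
  assumes q: "0 < q" "q < 1"
  shows "(\<lambda>n. signed_mean q (- int n) (int n)) \<longlonglongrightarrow> (1 - q) * qratio_series q (- q)"
proof -
  obtain C where C: "qratio q \<longlonglongrightarrow> C" "C > 0" by (rule qratio_limit[OF q])
  have 1: "(\<lambda>n. qratio q (Suc n)) \<longlonglongrightarrow> C" using C by (simp add: LIMSEQ_Suc)
  have 2: "(\<lambda>n. qratio q (Suc (n + n))) \<longlonglongrightarrow> C"
    using LIMSEQ_subseq_LIMSEQ[OF C(1), of "\<lambda>n. Suc (n + n)"] by (simp add: strict_mono_def comp_def)
  have 3: "(\<lambda>n. \<Sum>r\<le>n. (- q) ^ r * qratio q r) \<longlonglongrightarrow> qratio_series q (- q)"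
    using summable_LIMSEQ'[OF summable_qratio_series[OF q, of "- q"]] q
    by (simp add: qratio_series_def mult.commute)
  have "(\<lambda>n. q ^ Suc n) \<longlonglongrightarrow> 0" using q by (intro LIMSEQ_Suc LIMSEQ_power_zero) auto
  then have 4: "(\<lambda>n. (1 - q) / (1 - q ^ Suc n)) \<longlonglongrightarrow> (1 - q) / (1 - 0)"
    by (intro tendsto_divide tendsto_diff tendsto_const) auto
  show ?thesis
    using tendsto_mult[OF tendsto_mult[OF 4 3] tendsto_divide[OF 2 1]] C
    by (simp add: signed_mean_symmetric[OF q] signed_mean_zero[OF q] del: power_Suc)
qed

section \<open>The bi-infinite Mallows permutation\<close>

lemma (in prob_space) prob_tendsto_of_AE_eventually:
  assumes A: "\<And>n. A n \<in> events" and B: "B \<in> events"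
    and ev: "AE w in M. eventually (\<lambda>n. w \<in> A n \<longleftrightarrow> w \<in> B) sequentially"
  shows "(\<lambda>n. prob (A n)) \<longlonglongrightarrow> prob B"
proof -
  have "(\<lambda>n. \<integral>w. indicator (A n) w \<partial>M) \<longlonglongrightarrow> (\<integral>w. indicator B w \<partial>M :: real)"
  proof (rule integral_dominated_convergence[where w = "\<lambda>_. 1"])
    show "AE w in M. (\<lambda>n. indicator (A n) w :: real) \<longlonglongrightarrow> indicator B w"
      using ev
    proof eventually_elim
      case (elim w)
      then show ?case by (intro tendsto_eventually) (auto elim!: eventually_mono simp: indicator_def)
    qed
  qed (use A B in \<open>auto simp: indicator_def\<close>)
  then show ?thesis using A B by simp
qed

section \<open>One-sided inversion counts on the whole line\<close>

lemma finite_card_less_by_finite_subsets: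
  assumes "\<And>G. finite G \<Longrightarrow> G \<subseteq> F \<Longrightarrow> card G < m"
  shows "finite F \<and> card F < m"
proof -
  have "finite F \<and> card F \<le> m" by (rule finite_if_finite_subsets_card_bdd) (use assms in \<open>auto intro: less_imp_le\<close>)
  with assms[of F] show ?thesis by simp
qed

lemma right_smaller_card_less:
  assumes "\<And>k. card (right_smaller {y..y + int k} s y) < m"
  shows "finite (right_smaller UNIV s y) \<and> card (right_smaller UNIV s y) < m"
proof (rule finite_card_less_by_finite_subsets)
  fix G assume G: "finite G" "G \<subseteq> right_smaller UNIV s y"
  have "eventually (\<lambda>k. G \<subseteq> {y - int k..y + int k}) sequentially"
    by (rule eventually_interval_superset[OF G(1)])
  then obtain k where "G \<subseteq> {y - int k..y + int k}" by (auto simp: eventually_sequentially)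
  with G have "G \<subseteq> right_smaller {y..y + int k} s y" by (fastforce simp: right_smaller_def)
  then have "card G \<le> card (right_smaller {y..y + int k} s y)"
    by (intro card_mono finite_right_smaller) auto
  with assms[of k] show "card G < m" by simp
qed

lemma left_larger_card_less:
  assumes "\<And>k. card (left_larger {y - int k..y} s y) < m"
  shows "finite (left_larger UNIV s y) \<and> card (left_larger UNIV s y) < m"
proof (rule finite_card_less_by_finite_subsets)
  fix G assume G: "finite G" "G \<subseteq> left_larger UNIV s y"
  have "eventually (\<lambda>k. G \<subseteq> {y - int k..y + int k}) sequentially"
    by (rule eventually_interval_superset[OF G(1)])
  then obtain k where "G \<subseteq> {y - int k..y + int k}" by (auto simp: eventually_sequentially)
  with G have "G \<subseteq> left_larger {y - int k..y} s y" by (fastforce simp: left_larger_def)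
  then have "card G \<le> card (left_larger {y - int k..y} s y)"
    by (intro card_mono finite_left_larger) auto
  with assms[of k] show "card G < m" by simp
qed

lemma pattern_first_displacement:
  "pattern {y..y + int k} s y - y = int (card (right_smaller {y..y + int k} s y))"
proof -
  have "{c \<in> {y..y + int k}. s c < s y} = right_smaller {y..y + int k} s y"
    by (auto simp: right_smaller_def le_less)
  then show ?thesis using pattern_interval_rank[of y y "y + int k" s] by simp
qed

text \<open>Ties are counted, with \<open>\<le>\<close>, so that the identity holds for every
  function \<open>s\<close>. Events built from it are then described exactly on the whole sample
  space, including points where \<open>S w\<close> is not injective.\<close>

lemma pattern_last_displacement:
  "y - pattern {y - int k..y} s y = int (card {c \<in> {y - int k..<y}. s y \<le> s c})"
proof -
  let ?A = "{c \<in> {y - int k..y}. s c < s y}" and ?B = "{c \<in> {y - int k..<y}. s y \<le> s c}"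
  have "?A \<union> ?B = {y - int k..<y}"
    by (auto simp: le_less)
  moreover have "card (?A \<union> ?B) = card ?A + card ?B"
    by (rule card_Un_disjoint) (auto simp: not_less intro: finite_subset[of _ "{y - int k..y}"])
  moreover have "card {y - int k..<y} = k" by simp
  ultimately have "k = card ?A + card ?B" by (simp only:)
  moreover have "pattern {y - int k..y} s y = y - int k + int (card ?A)"
    by (rule pattern_interval_rank) simp
  ultimately show ?thesis by linarith
qed

text \<open>A finite set containing the patterns of all functions on an interval, also of
  non-injective ones. Finiteness reduces measurability and equality of laws to single
  patterns.\<close>

definition pattern_range :: "int set \<Rightarrow> (int \<Rightarrow> int) set" where
  "pattern_range A = (\<lambda>f x. if x \<in> A then f x else x) ` (A \<rightarrow>\<^sub>E A)"

lemma finite_pattern_range: "finite A \<Longrightarrow> finite (pattern_range A)"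
  by (simp add: pattern_range_def finite_PiE)

lemma pattern_rangeI:
  assumes "\<And>x. x \<in> A \<Longrightarrow> f x \<in> A" "\<And>x. x \<notin> A \<Longrightarrow> f x = x"
  shows "f \<in> pattern_range A"
  unfolding pattern_range_def using assms
  by (intro image_eqI[where x = "restrict f A"]) (auto intro!: ext)

lemma pattern_in_range: "pattern {a..b} s \<in> pattern_range {a..b}"
  by (rule pattern_rangeI) (use pattern_interval_in in \<open>auto simp: pattern_def\<close>)

text \<open>The parameter \<open>q\<close> of this locale lies below 1; it will be the reciprocal of
  the one in the theorem.\<close>

locale mallows_line = prob_space M for M :: "'a measure" +
  fixes S :: "'a \<Rightarrow> int \<Rightarrow> int" and q :: real
  assumes q: "0 < q" "q < 1"
    and measurable_S: "S \<in> measurable M (PiM UNIV (\<lambda>_. count_space UNIV))"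
    and bij_S: "AE w in M. bij (S w)"
    and law: "\<And>a b s. prob {w \<in> space M. pattern {a..b} (S w) = s} = pmf (mallows {a..b} q) s"
    and pattern_limit: "AE w in M. \<forall>i. eventually (\<lambda>n. pattern {- int n..int n} (S w) i = S w i) sequentially"
begin

section \<open>Measurability and laws of interval patterns\<close>

lemma measurable_coord [measurable]: "(\<lambda>w. S w x) \<in> measurable M (count_space UNIV)"
  using measurable_compose[OF measurable_S measurable_component_singleton[of x UNIV]] by simp

text \<open>The set of points with smaller value is one of finitely many subsets \<open>T\<close> of
  the interval, and each \<open>T\<close> gives a condition on finitely many coordinates.\<close>

lemma pred_rank:
  "Measurable.pred M (\<lambda>w. card {c \<in> {a..b}. S w c < S w y} = k)"
proof -
  have "(card {c \<in> {a..b}. S w c < S w y} = k)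
     \<longleftrightarrow> (\<exists>T\<in>{T \<in> Pow {a..b}. card T = k}. \<forall>c\<in>{a..b}. S w c < S w y \<longleftrightarrow> c \<in> T)" for w
  proof
    assume "card {c \<in> {a..b}. S w c < S w y} = k"
    then show "\<exists>T\<in>{T \<in> Pow {a..b}. card T = k}. \<forall>c\<in>{a..b}. S w c < S w y \<longleftrightarrow> c \<in> T"
      by (intro bexI[of _ "{c \<in> {a..b}. S w c < S w y}"]) auto
  next
    assume "\<exists>T\<in>{T \<in> Pow {a..b}. card T = k}. \<forall>c\<in>{a..b}. S w c < S w y \<longleftrightarrow> c \<in> T"
    then obtain T where T: "T \<subseteq> {a..b}" "card T = k" "\<forall>c\<in>{a..b}. S w c < S w y \<longleftrightarrow> c \<in> T" by auto
    then have "{c \<in> {a..b}. S w c < S w y} = T" by blast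
    with T show "card {c \<in> {a..b}. S w c < S w y} = k" by simp
  qed
  moreover have "Measurable.pred M (\<lambda>w. \<exists>T\<in>{T \<in> Pow {a..b}. card T = k}. \<forall>c\<in>{a..b}. S w c < S w y \<longleftrightarrow> c \<in> T)"
    by (rule pred_intros_finite(4)) (simp, measurable)
  ultimately show ?thesis by simp
qed

lemma pattern_eq_event: "{w \<in> space M. pattern {a..b} (S w) = s} \<in> events"
proof (cases "\<forall>x. x \<notin> {a..b} \<longrightarrow> s x = x")
  case True
  have "pattern {a..b} (S w) = s \<longleftrightarrow> (\<forall>x\<in>{a..b}. card {c \<in> {a..b}. S w c < S w x} = nat (s x - a) \<and> a \<le> s x)" for w
  proof -
    have "pattern {a..b} (S w) = s \<longleftrightarrow> (\<forall>x\<in>{a..b}. pattern {a..b} (S w) x = s x)"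
      using True by (auto simp: pattern_def fun_eq_iff)
    also have "\<dots> \<longleftrightarrow> (\<forall>x\<in>{a..b}. card {c \<in> {a..b}. S w c < S w x} = nat (s x - a) \<and> a \<le> s x)"
      by (intro ball_cong refl) (auto simp only: pattern_interval_rank)
    finally show ?thesis .
  qed
  then have "{w \<in> space M. pattern {a..b} (S w) = s}
    = {w \<in> space M. \<forall>x\<in>{a..b}. card {c \<in> {a..b}. S w c < S w x} = nat (s x - a) \<and> a \<le> s x}" by simp
  also have "\<dots> \<in> events"
    by (intro predE pred_intros_finite pred_intros_logic pred_rank) auto
  finally show ?thesis .
next
  case False
  then have "{w \<in> space M. pattern {a..b} (S w) = s} = {}" by (auto simp: pattern_def)
  then show ?thesis by (simp only: sets.empty_sets)
qed

lemma measurable_pattern [measurable]: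
  "(\<lambda>w. pattern {a..b} (S w)) \<in> measurable M (count_space UNIV)"
proof -
  let ?R = "pattern_range {a..b}"
  have "(\<lambda>w. pattern {a..b} (S w)) -` X \<inter> space M \<in> events" for X
  proof -
    have "(\<lambda>w. pattern {a..b} (S w)) -` X \<inter> space M
      = (\<Union>s\<in>X \<inter> ?R. {w \<in> space M. pattern {a..b} (S w) = s})"
      using pattern_in_range by auto
    also have "\<dots> \<in> events"
      using finite_pattern_range[of "{a..b}"] by (intro sets.finite_UN pattern_eq_event) simp
    finally show ?thesis .
  qed
  then show ?thesis by (intro measurableI) auto
qed

lemma distr_pattern: "distr M (count_space UNIV) (\<lambda>w. pattern {a..b} (S w)) = measure_pmf (mallows {a..b} q)"
proof (rule measure_eqI_countable_AE)
  let ?R = "pattern_range {a..b}"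
  show "countable ?R" by (intro countable_finite finite_pattern_range) simp
  show "AE x in distr M (count_space UNIV) (\<lambda>w. pattern {a..b} (S w)). x \<in> ?R"
    by (subst AE_distr_iff) (auto simp: pattern_in_range)
  show "AE x in measure_pmf (mallows {a..b} q). x \<in> ?R"
  proof (rule AE_pmfI)
    fix s assume "s \<in> set_pmf (mallows {a..b} q)"
    then have s: "s permutes {a..b}" using q by (simp add: set_pmf_mallows)
    show "s \<in> ?R"
    proof (rule pattern_rangeI)
      show "s x \<in> {a..b}" if "x \<in> {a..b}" for x using that by (simp only: permutes_in_image[OF s])
      show "s x = x" if "x \<notin> {a..b}" for x using permutes_not_in[OF s that] .
    qed
  qed
  fix s assume "s \<in> ?R"
  show "emeasure (distr M (count_space UNIV) (\<lambda>w. pattern {a..b} (S w))) {s} = emeasure (measure_pmf (mallows {a..b} q)) {s}"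
    using law[of a b s]
    by (subst emeasure_distr) (auto simp: emeasure_pmf_single emeasure_eq_measure vimage_def Int_def conj_commute)
qed auto

lemma prob_pattern:
  "prob {w \<in> space M. pattern {a..b} (S w) \<in> X} = measure_pmf.prob (mallows {a..b} q) X"
  unfolding distr_pattern[symmetric]
  by (subst measure_distr) (auto intro!: arg_cong[where f = prob])

lemma expectation_pattern:
  fixes f :: "(int \<Rightarrow> int) \<Rightarrow> real"
  shows "expectation (\<lambda>w. f (pattern {a..b} (S w))) = measure_pmf.expectation (mallows {a..b} q) f"
  unfolding distr_pattern[symmetric] by (subst integral_distr) auto

lemma pattern_event: "{w \<in> space M. pattern {a..b} (S w) \<in> X} \<in> events"
proof -
  have "(\<lambda>w. pattern {a..b} (S w)) -` X \<inter> space M \<in> events"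
    by (rule measurable_sets[OF measurable_pattern]) simp
  then show ?thesis by (simp add: vimage_def Int_def conj_commute)
qed

text \<open>In the window \<open>{y..y + k}\<close> the point \<open>y\<close> comes first, so each
  \<open>F k\<close> has probability at most \<open>q ^ m\<close>. These events increase with
  \<open>k\<close>, so their union obeys the same bound; outside it all finite subsets have fewer
  than \<open>m\<close> elements, which also yields finiteness.\<close>

lemma right_tail_event:
  "\<exists>B\<in>events. prob B \<le> q ^ m \<and> (\<forall>w\<in>space M - B.
     finite (right_smaller UNIV (S w) y) \<and> card (right_smaller UNIV (S w) y) < m)"
proof -
  define F where "F k = {w \<in> space M. pattern {y..y + int k} (S w) \<in> {s. int m \<le> s y - y}}" for k :: nat
  have F: "F k \<in> events" for k unfolding F_def by (rule pattern_event)
  have F_eq: "F k = {w \<in> space M. m \<le> card (right_smaller {y..y + int k} (S w) y)}" for k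
    by (simp add: F_def pattern_first_displacement)
  have "incseq F"
  proof (rule incseq_SucI)
    fix k
    have "card (right_smaller {y..y + int k} s y) \<le> card (right_smaller {y..y + int (Suc k)} s y)" for s
      by (intro card_mono right_smaller_mono finite_right_smaller) auto
    then show "F k \<subseteq> F (Suc k)" unfolding F_eq using le_trans by blast
  qed
  then have "(\<lambda>k. prob (F k)) \<longlonglongrightarrow> prob (\<Union>k. F k)"
    by (rule finite_Lim_measure_incseq[rotated]) (use F in auto)
  moreover have "prob (F k) \<le> q ^ m" for k
    unfolding F_def prob_pattern by (rule mallows_first_tail[OF q]) simp
  ultimately have "prob (\<Union>k. F k) \<le> q ^ m" by (intro LIMSEQ_le_const2) auto
  moreover have "finite (right_smaller UNIV (S w) y) \<and> card (right_smaller UNIV (S w) y) < m"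
    if "w \<in> space M - (\<Union>k. F k)" for w
    using that by (intro right_smaller_card_less) (auto simp: F_eq not_le)
  moreover have "(\<Union>k. F k) \<in> events" using F by auto
  ultimately show ?thesis by blast
qed

lemma left_tail_event:
  "\<exists>B\<in>events. prob B \<le> q ^ m \<and> (\<forall>w\<in>space M - B.
     finite (left_larger UNIV (S w) y) \<and> card (left_larger UNIV (S w) y) < m)"
proof -
  define F where "F k = {w \<in> space M. pattern {y - int k..y} (S w) \<in> {s. int m \<le> y - s y}}" for k :: nat
  have F: "F k \<in> events" for k unfolding F_def by (rule pattern_event)
  have F_eq: "F k = {w \<in> space M. m \<le> card {c \<in> {y - int k..<y}. S w y \<le> S w c}}" for k
    by (simp add: F_def pattern_last_displacement)
  have "incseq F"
  proof (rule incseq_SucI)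
    fix k
    have "card {c \<in> {y - int k..<y}. s y \<le> s c} \<le> card {c \<in> {y - int (Suc k)..<y}. s y \<le> s c}"
      for s :: "int \<Rightarrow> int"
      by (intro card_mono finite_Collect_conjI disjI1) auto
    then show "F k \<subseteq> F (Suc k)" unfolding F_eq using le_trans by blast
  qed
  then have "(\<lambda>k. prob (F k)) \<longlonglongrightarrow> prob (\<Union>k. F k)"
    by (rule finite_Lim_measure_incseq[rotated]) (use F in auto)
  moreover have "prob (F k) \<le> q ^ m" for k
    unfolding F_def prob_pattern by (rule mallows_last_tail[OF q]) simp
  ultimately have "prob (\<Union>k. F k) \<le> q ^ m" by (intro LIMSEQ_le_const2) auto
  moreover have "finite (left_larger UNIV (S w) y) \<and> card (left_larger UNIV (S w) y) < m"
    if w: "w \<in> space M - (\<Union>k. F k)" for w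
  proof (rule left_larger_card_less)
    fix k
    have "card (left_larger {y - int k..y} (S w) y) \<le> card {c \<in> {y - int k..<y}. S w y \<le> S w c}"
      by (intro card_mono finite_Collect_conjI disjI1) (auto simp: left_larger_def)
    with w show "card (left_larger {y - int k..y} (S w) y) < m" by (auto simp: F_eq not_le intro: le_less_trans)
  qed
  moreover have "(\<Union>k. F k) \<in> events" using F by auto
  ultimately show ?thesis by blast
qed

end

text \<open>Compared with the \<open>j\<close>-th power of the \<open>i\<close>-th root of
  \<open>q\<close>, rounding the exponent \<open>j / i\<close> down loses at most a factor
  \<open>1 / q\<close>.\<close>

lemma summable_power_div:
  fixes q :: real
  assumes q: "0 < q" "q < 1" and i: "i > 0"
  shows "summable (\<lambda>j. q ^ (j div i))"
proof (rule summable_comparison_test')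
  let ?s = "root i q"
  have s: "0 < ?s" "?s < 1" using q i by auto
  show "summable (\<lambda>j. ?s ^ j / q)" using s by (intro summable_divide summable_geometric) auto
  fix j :: nat
  have "q ^ (j div i) * q = ?s ^ (i * (j div i)) * ?s ^ i"
    using q i by (simp add: power_mult)
  also have "\<dots> \<le> ?s ^ (i * (j div i)) * ?s ^ (j mod i)"
    using s i by (intro mult_left_mono power_decreasing) (auto intro: less_imp_le)
  also have "\<dots> = ?s ^ j" by (simp add: power_add[symmetric])
  finally show "norm (q ^ (j div i)) \<le> ?s ^ j / q" using q by (simp add: pos_le_divide_eq)
qed

section \<open>Almost sure sublinear displacement\<close>

context mallows_line
begin

lemma tail_event:
  "\<exists>B\<in>events. prob B \<le> 2 * q ^ m \<and> (\<forall>w\<in>space M - B.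
     finite (right_smaller UNIV (S w) y) \<and> card (right_smaller UNIV (S w) y) \<le> m \<and>
     finite (left_larger UNIV (S w) y) \<and> card (left_larger UNIV (S w) y) \<le> m)"
proof -
  obtain B where B: "B \<in> events" "prob B \<le> q ^ m" "\<forall>w\<in>space M - B.
     finite (right_smaller UNIV (S w) y) \<and> card (right_smaller UNIV (S w) y) < m"
    using right_tail_event[of m y] by blast
  obtain C where C: "C \<in> events" "prob C \<le> q ^ m" "\<forall>w\<in>space M - C.
     finite (left_larger UNIV (S w) y) \<and> card (left_larger UNIV (S w) y) < m"
    using left_tail_event[of m y] by blast
  have "prob (B \<union> C) \<le> prob B + prob C" using B C by (intro measure_Un_le)
  with B C show ?thesis by (intro bexI[of _ "B \<union> C"]) (auto intro: less_imp_le)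
qed

text \<open>The tails are summable over \<open>y\<close>, so the bad event \<open>N K\<close> that
  some \<open>y\<close> violates the bound with constant \<open>K\<close> has probability at most a
  constant times \<open>q ^ K\<close>. Hence almost surely some \<open>K\<close> is not bad.\<close>

lemma AE_linear_bound:
  assumes i: "i > 0"
  shows "AE w in M. \<exists>K. \<forall>y.
     finite (right_smaller UNIV (S w) y) \<and> card (right_smaller UNIV (S w) y) \<le> K + nat \<bar>y\<bar> div i \<and>
     finite (left_larger UNIV (S w) y) \<and> card (left_larger UNIV (S w) y) \<le> K + nat \<bar>y\<bar> div i"
    (is "AE w in M. \<exists>K. \<forall>y. ?good w (K + nat \<bar>y\<bar> div i) y")
proof -
  obtain B where B: "\<And>m y. B m y \<in> events" "\<And>m y. prob (B m y) \<le> 2 * q ^ m"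
    "\<And>m y w. w \<in> space M \<Longrightarrow> w \<notin> B m y \<Longrightarrow> ?good w m y"
    using tail_event by (metis Diff_iff)
  define N where "N K = (\<Union>j. B (K + j div i) (int j) \<union> B (K + j div i) (- int j))" for K
  \<comment> \<open>The factor 4 is the 2 of \<open>tail_event\<close> times the two points
    \<open>j\<close> and \<open>- j\<close>.\<close>
  define C where "C = (\<Sum>j. 4 * q ^ (j div i))"
  have N: "N K \<in> events" for K unfolding N_def using B(1) by auto
  have le: "prob (N K) \<le> q ^ K * C" for K
  proof -
    let ?B = "\<lambda>j. B (K + j div i) (int j) \<union> B (K + j div i) (- int j)"
    have sm: "summable (\<lambda>j. q ^ K * (4 * q ^ (j div i)))"
      by (intro summable_mult summable_power_div q i)
    have p: "prob (?B j) \<le> q ^ K * (4 * q ^ (j div i))" for j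
    proof -
      have "prob (?B j) \<le> prob (B (K + j div i) (int j)) + prob (B (K + j div i) (- int j))"
        by (intro measure_Un_le B)
      also have "\<dots> \<le> q ^ K * (4 * q ^ (j div i))"
        using B(2)[of "K + j div i" "int j"] B(2)[of "K + j div i" "- int j"] by (simp add: power_add)
      finally show ?thesis .
    qed
    have sp: "summable (\<lambda>j. prob (?B j))"
      by (rule summable_comparison_test'[OF sm]) (use p in simp)
    have "prob (N K) \<le> (\<Sum>j. prob (?B j))"
      unfolding N_def using B(1) sp by (intro finite_measure_subadditive_countably) auto
    also have "\<dots> \<le> (\<Sum>j. q ^ K * (4 * q ^ (j div i)))" by (rule suminf_le[OF p sp sm])
    also have "\<dots> = q ^ K * C" unfolding C_def
      by (intro suminf_mult summable_mult summable_power_div q i)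
    finally show ?thesis .
  qed
  have "(\<lambda>K. q ^ K * C) \<longlonglongrightarrow> 0 * C"
    using q by (intro tendsto_mult_right LIMSEQ_power_zero) auto
  moreover have "prob (\<Inter>K. N K) \<le> q ^ K * C" for K
  proof -
    have "prob (\<Inter>K. N K) \<le> prob (N K)" using N by (intro finite_measure_mono) auto
    with le[of K] show ?thesis by simp
  qed
  ultimately have "prob (\<Inter>K. N K) \<le> 0 * C" by (intro LIMSEQ_le_const) auto
  then have null: "prob (\<Inter>K. N K) = 0" by (simp add: measure_le_0_iff)
  show ?thesis
  proof (rule AE_I)
    show "emeasure M (\<Inter>K. N K) = 0" using null by (simp add: emeasure_eq_measure)
    show "(\<Inter>K. N K) \<in> events" using N by auto
    show "{w \<in> space M. \<not> (\<exists>K. \<forall>y. ?good w (K + nat \<bar>y\<bar> div i) y)} \<subseteq> (\<Inter>K. N K)"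
    proof safe
      fix w K assume w: "w \<in> space M" "\<not> (\<exists>K. \<forall>y. ?good w (K + nat \<bar>y\<bar> div i) y)"
      then obtain y where "\<not> ?good w (K + nat \<bar>y\<bar> div i) y" by blast
      with B(3) w(1) have "w \<in> B (K + nat \<bar>y\<bar> div i) y" by blast
      then show "w \<in> N K" unfolding N_def
        by (intro UN_I[of "nat \<bar>y\<bar>"]) (auto simp: abs_if split: if_splits)
    qed
  qed
qed

lemma AE_tame: "AE w in M. tame (S w)"
proof -
  let ?g = "\<lambda>w i K y. finite (right_smaller UNIV (S w) y) \<and> card (right_smaller UNIV (S w) y) \<le> K + nat \<bar>y\<bar> div i \<and>
     finite (left_larger UNIV (S w) y) \<and> card (left_larger UNIV (S w) y) \<le> K + nat \<bar>y\<bar> div i"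
  have "AE w in M. \<forall>i. i > 0 \<longrightarrow> (\<exists>K. \<forall>y. ?g w i K y)"
    unfolding AE_all_countable using AE_linear_bound by auto
  with bij_S pattern_limit show ?thesis
  proof eventually_elim
    case (elim w)
    have "finite (right_smaller UNIV (S w) y) \<and> finite (left_larger UNIV (S w) y)" for y
      using elim(3)[rule_format, of 1] by auto
    moreover have "\<exists>K. \<forall>y. int (card (right_smaller UNIV (S w) y)) \<le> int K + \<bar>y\<bar> div int i \<and>
                    int (card (left_larger UNIV (S w) y)) \<le> int K + \<bar>y\<bar> div int i" if "i > 0" for i
    proof -
      from elim(3)[rule_format, OF that] obtain K where K: "\<forall>y. ?g w i K y" ..
      show ?thesis
      proof (intro exI allI conjI)
        fix y
        have e: "int K + \<bar>y\<bar> div int i = int (K + nat \<bar>y\<bar> div i)" by (simp add: zdiv_int)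
        show "int (card (right_smaller UNIV (S w) y)) \<le> int K + \<bar>y\<bar> div int i"
          using K[rule_format, of y] unfolding e by (simp only: of_nat_le_iff)
        show "int (card (left_larger UNIV (S w) y)) \<le> int K + \<bar>y\<bar> div int i"
          using K[rule_format, of y] unfolding e by (simp only: of_nat_le_iff)
      qed
    qed
    ultimately show ?case unfolding tame_def using elim(1,2) bij_is_inj by blast
  qed
qed

section \<open>Measurability and convergence of the cycle counts\<close>

lemma measurable_funpow:
  fixes f :: "int \<Rightarrow> int"
  shows "(\<lambda>w. ((f \<circ> S w) ^^ j) x) \<in> measurable M (count_space UNIV)"
proof (induction j)
  case 0 show ?case by (simp only: funpow_0 measurable_const space_count_space UNIV_I)
next
  case (Suc j)
  have "(\<lambda>w. S w (((f \<circ> S w) ^^ j) x)) \<in> measurable M (count_space UNIV)"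
    by (rule measurable_compose_countable[OF measurable_coord Suc])
  then have "(\<lambda>w. f (S w (((f \<circ> S w) ^^ j) x))) \<in> measurable M (count_space UNIV)"
    by (rule measurable_compose) simp
  moreover have "((f \<circ> S w) ^^ Suc j) x = f (S w (((f \<circ> S w) ^^ j) x))" for w by simp
  ultimately show ?case by (simp only:)
qed

text \<open>For a fixed finite collection of finite sets, equality with the set of cycles unfolds
  into countable quantifiers over conditions on finitely many iterates.\<close>

lemma pred_cycles_len:
  assumes C: "finite C" "\<And>c. c \<in> C \<Longrightarrow> finite c"
  shows "Measurable.pred M (\<lambda>w. cycles_len UNIV i (f \<circ> S w) = C)"
proof -
  note [measurable] = measurable_funpow
  define orb where "orb w x = {((f \<circ> S w) ^^ j) x | j. j < i}" for w x
  have orb: "Measurable.pred M (\<lambda>w. orb w x = c)" if "finite c" for x c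
  proof -
    have "orb w x = c \<longleftrightarrow> (\<forall>j\<in>{..<i}. ((f \<circ> S w) ^^ j) x \<in> c) \<and> (\<forall>y\<in>c. \<exists>j\<in>{..<i}. ((f \<circ> S w) ^^ j) x = y)" for w
      by (auto simp: orb_def)
    then show ?thesis using that by (simp only:) measurable
  qed
  have cyc: "Measurable.pred M (\<lambda>w. x \<in> cyc_pts UNIV i (f \<circ> S w))" for x
    unfolding cyc_pts_def by simp measurable
  have img: "h ` A = C \<longleftrightarrow> (\<forall>x. x \<in> A \<longrightarrow> (\<exists>c\<in>C. h x = c)) \<and> (\<forall>c\<in>C. \<exists>x. x \<in> A \<and> h x = c)"
    for h :: "int \<Rightarrow> int set" and A
  proof
    assume "h ` A = C"
    then show "(\<forall>x. x \<in> A \<longrightarrow> (\<exists>c\<in>C. h x = c)) \<and> (\<forall>c\<in>C. \<exists>x. x \<in> A \<and> h x = c)" by blast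
  next
    assume "(\<forall>x. x \<in> A \<longrightarrow> (\<exists>c\<in>C. h x = c)) \<and> (\<forall>c\<in>C. \<exists>x. x \<in> A \<and> h x = c)"
    then show "h ` A = C" by (intro equalityI subsetI) (force, metis imageI)
  qed
  have "cycles_len UNIV i (f \<circ> S w) = orb w ` cyc_pts UNIV i (f \<circ> S w)" for w
    unfolding cycles_len_def by (rule image_cong[OF refl]) (simp only: orb_def)
  then have "{w \<in> space M. cycles_len UNIV i (f \<circ> S w) = C}
    = {w \<in> space M. (\<forall>x. x \<in> cyc_pts UNIV i (f \<circ> S w) \<longrightarrow> (\<exists>c\<in>C. orb w x = c))
      \<and> (\<forall>c\<in>C. \<exists>x. x \<in> cyc_pts UNIV i (f \<circ> S w) \<and> orb w x = c)}"
    by (simp only: img)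
  also have "\<dots> \<in> events"
    using C cyc orb unfolding pred_def
    by (intro sets.sets_Collect_conj sets.sets_Collect_countable_All sets.sets_Collect_imp
        sets.sets_Collect_finite_Ex sets.sets_Collect_finite_All sets.sets_Collect_countable_Ex) auto
  finally show ?thesis by (simp only: pred_def)
qed

lemma finite_cycles_len_elem: "c \<in> cycles_len D i g \<Longrightarrow> finite c"
  by (auto simp: cycles_len_def)

text \<open>There are only countably many finite collections of finite sets of integers, so the
  event is a countable union.\<close>

lemma pred_cycle_count: "Measurable.pred M (\<lambda>w. cycle_count UNIV i (f \<circ> S w) = enat m)"
proof -
  let ?F = "{C. finite C \<and> C \<subseteq> {c :: int set. finite c}}"
  let ?X = "{C \<in> ?F. card C = m}"
  have "countable ?F" by (intro countable_Collect_finite_subset countable_Collect_finite)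
  then have cX: "countable ?X" by (rule countable_subset[rotated]) auto
  have "cycle_count UNIV i (f \<circ> S w) = enat m \<longleftrightarrow> (\<exists>C\<in>?X. cycles_len UNIV i (f \<circ> S w) = C)" for w
    using finite_cycles_len_elem[of _ UNIV i "f \<circ> S w"] by (auto simp: cycle_count_def)
  then have "{w \<in> space M. cycle_count UNIV i (f \<circ> S w) = enat m}
    = {w \<in> space M. \<exists>C\<in>?X. cycles_len UNIV i (f \<circ> S w) = C}" by (simp only:)
  moreover have "{w \<in> space M. \<exists>C\<in>?X. cycles_len UNIV i (f \<circ> S w) = C} \<in> events"
    using cX by (intro sets.sets_Collect_countable_Ex' predE pred_cycles_len) auto
  ultimately show ?thesis by (simp only: pred_def)
qed

lemma odd_cycles_event: "{w \<in> space M. odd_cycles UNIV (length xs) (f \<circ> S w) = map enat xs} \<in> events"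
proof -
  have "odd_cycles UNIV (length xs) (f \<circ> S w) = map enat xs
    \<longleftrightarrow> (\<forall>j\<in>{..<length xs}. cycle_count UNIV (2 * j + 1) (f \<circ> S w) = enat (xs ! j))" for w
  proof -
    have "map enat xs = map (\<lambda>j. enat (xs ! j)) [0..<length xs]" by (rule nth_equalityI) auto
    then show ?thesis by (simp only: odd_cycles_def map_eq_conv set_upt lessThan_atLeast0)
  qed
  then have "{w \<in> space M. odd_cycles UNIV (length xs) (f \<circ> S w) = map enat xs}
    = {w \<in> space M. \<forall>j\<in>{..<length xs}. cycle_count UNIV (2 * j + 1) (f \<circ> S w) = enat (xs ! j)}"
    by (simp only:)
  also have "\<dots> \<in> events"
    by (rule sets.sets_Collect_finite_All) (rule pred_cycle_count[unfolded pred_def], simp)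
  finally show ?thesis .
qed

lemma AE_cycle_count_finite:
  "AE w in M. \<forall>j. cycle_count UNIV (2 * j + 1) (refl_about c \<circ> S w) \<noteq> \<infinity>"
  using AE_tame
proof eventually_elim
  case (elim w)
  show ?case by (intro allI tame_cycles(1)[OF elim]) simp
qed

lemma odd_cycles_limit:
  "(\<lambda>n. measure_pmf.prob (mallows {c - int n..int n} q)
      {s. odd_cycles {c - int n..int n} (length xs) (refl_about c \<circ> s) = map enat xs})
   \<longlonglongrightarrow> prob {w \<in> space M. odd_cycles UNIV (length xs) (refl_about c \<circ> S w) = map enat xs}"
proof -
  have "(\<lambda>n. prob {w \<in> space M. pattern {c - int n..int n} (S w)
        \<in> {s. odd_cycles {c - int n..int n} (length xs) (refl_about c \<circ> s) = map enat xs}})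
     \<longlonglongrightarrow> prob {w \<in> space M. odd_cycles UNIV (length xs) (refl_about c \<circ> S w) = map enat xs}"
  proof (rule prob_tendsto_of_AE_eventually[OF pattern_event odd_cycles_event])
    let ?A = "\<lambda>n. {w \<in> space M. pattern {c - int n..int n} (S w)
        \<in> {s. odd_cycles {c - int n..int n} (length xs) (refl_about c \<circ> s) = map enat xs}}"
    let ?B = "{w \<in> space M. odd_cycles UNIV (length xs) (refl_about c \<circ> S w) = map enat xs}"
    show "AE w in M. eventually (\<lambda>n. w \<in> ?A n \<longleftrightarrow> w \<in> ?B) sequentially"
      using AE_tame
    proof eventually_elim
      case (elim w)
      have "eventually (\<lambda>n. cycle_count {c - int n..int n} (2 * j + 1) (refl_about c \<circ> pattern {c - int n..int n} (S w))
          = cycle_count UNIV (2 * j + 1) (refl_about c \<circ> S w)) sequentially" for j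
        by (rule tame_cycles(2)[OF elim]) simp
      then have "eventually (\<lambda>n. \<forall>j\<in>{..<length xs}.
          cycle_count {c - int n..int n} (2 * j + 1) (refl_about c \<circ> pattern {c - int n..int n} (S w))
          = cycle_count UNIV (2 * j + 1) (refl_about c \<circ> S w)) sequentially"
        by (intro eventually_ball_finite ballI) auto
      then show ?case
      proof eventually_elim
        case (elim n)
        then have "odd_cycles {c - int n..int n} (length xs) (refl_about c \<circ> pattern {c - int n..int n} (S w))
            = odd_cycles UNIV (length xs) (refl_about c \<circ> S w)"
          by (auto simp: odd_cycles_def)
        then show ?case by simp
      qed
    qed
  qed
  then show ?thesis by (simp only: prob_pattern)
qed

end

section \<open>Finite cycle counts under reversal of values\<close>

lemma funpow_translate:
  fixes t :: int
  assumes g: "\<And>x. x \<in> B \<Longrightarrow> g x = s (x + t) - t" and inv: "g ` B \<subseteq> B" and x: "x \<in> B"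
  shows "(g ^^ j) x \<in> B \<and> (s ^^ j) (x + t) = (g ^^ j) x + t"
  using x inv by (induction j) (auto simp: g)

lemma cycle_count_translate:
  fixes t :: int
  assumes g: "\<And>x. x \<in> B \<Longrightarrow> g x = s (x + t) - t" and inv: "g ` B \<subseteq> B"
  shows "cycle_count ((\<lambda>x. x + t) ` B) i s = cycle_count B i g"
proof -
  note fp = funpow_translate[OF g inv]
  have pts: "cyc_pts ((\<lambda>x. x + t) ` B) i s = (\<lambda>x. x + t) ` cyc_pts B i g"
    using fp by (auto simp: cyc_pts_def)
  have orb: "{(s ^^ j) (x + t) | j. j < i} = (\<lambda>x. x + t) ` {(g ^^ j) x | j. j < i}" if "x \<in> cyc_pts B i g" for x
    using fp[of x] that by (auto simp: cyc_pts_def)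
  have "cycles_len ((\<lambda>x. x + t) ` B) i s = image (\<lambda>x. x + t) ` cycles_len B i g"
    unfolding cycles_len_def pts image_image by (intro image_cong refl orb)
  moreover have "inj_on (image (\<lambda>x. x + t)) (cycles_len B i g)"
    by (rule inj_on_subset[OF inj_on_image[of _ UNIV]]) (auto simp: inj_on_def)
  ultimately show ?thesis by (simp add: cycle_count_def card_image finite_image_iff)
qed

text \<open>With \<open>t = n + 1 - c\<close>, reflecting the reversed permutation gives
  \<open>x \<mapsto> s (x + t) - t\<close>, the conjugate of \<open>s\<close> by a translation,
  which has the same cycle counts. The window has \<open>2 * n + 1\<close> points for
  \<open>c = 0\<close> and \<open>2 * n\<close> for \<open>c = 1\<close>.\<close>

lemma prob_odd_cycles_reverse:
  assumes "q > 0"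
  shows "measure_pmf.prob (mallows {1..2 * int n + 1 - c} q)
      {s. odd_cycles {1..2 * int n + 1 - c} k s = xs}
    = measure_pmf.prob (mallows {c - int n..int n} (1 / q))
      {s. odd_cycles {c - int n..int n} k (refl_about c \<circ> s) = xs}"
proof -
  let ?B = "{c - int n..int n}" and ?A = "{1..2 * int n + 1 - c}"
  define t where "t = 1 - (c - int n)"
  let ?F = "relabel (\<lambda>x. x + t) (\<lambda>x. int n + 1 - x) ?B"
  have A: "?A = {1..int n + 1 - (c - int n)}" by simp
  have im: "(\<lambda>x. x + t) ` ?B = ?A"
    using image_add_atLeastAtMost'[of t "c - int n" "int n"] by (simp add: t_def algebra_simps)
  have "odd_cycles ?A k s = odd_cycles ?B k (refl_about c \<circ> ?F s)" if s: "s permutes ?A" for s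
  proof -
    have eq: "(refl_about c \<circ> ?F s) x = s (x + t) - t" if "x \<in> ?B" for x
      using that by (simp add: relabel_def refl_about_def t_def)
    have "(refl_about c \<circ> ?F s) ` ?B \<subseteq> ?B"
    proof (rule image_subsetI)
      fix x assume x: "x \<in> ?B"
      then have "x + t \<in> ?A" using im by blast
      then have "s (x + t) \<in> ?A" by (simp only: permutes_in_image[OF s])
      then show "(refl_about c \<circ> ?F s) x \<in> ?B" by (simp only: eq[OF x]) (auto simp: t_def)
    qed
    from cycle_count_translate[of ?B "refl_about c \<circ> ?F s" s t, OF eq this]
    show ?thesis by (simp only: odd_cycles_def im)
  qed
  then have "measure_pmf.prob (mallows ?A q) {s. odd_cycles ?A k s = xs}
     = measure_pmf.prob (mallows ?A q) (?F -` {s. odd_cycles ?B k (refl_about c \<circ> s) = xs})"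
    using assms by (intro measure_pmf.finite_measure_eq_AE AE_pmfI) (auto simp: set_pmf_mallows)
  also have "\<dots> = measure_pmf.prob (map_pmf ?F (mallows ?A q)) {s. odd_cycles ?B k (refl_about c \<circ> s) = xs}"
    by simp
  also have "map_pmf ?F (mallows ?A q) = mallows ?B (1 / q)"
    unfolding A t_def by (rule mallows_reverse[OF assms])
  finally show ?thesis .
qed

section \<open>Fixed points distinguish the two limits\<close>

lemma cycles_len_1: "cycles_len UNIV 1 g = (\<lambda>x. {x}) ` {x. g x = x}"
  by (auto simp: cycles_len_def cyc_pts_def)

lemma cycle_count_1:
  "cycle_count UNIV 1 g = enat m \<longleftrightarrow> finite {x. g x = x} \<and> card {x. g x = x} = m"
proof -
  have "inj_on (\<lambda>x. {x}) {x. g x = x}" by simp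
  then show ?thesis
    unfolding cycle_count_def cycles_len_1 by (auto simp: card_image finite_image_iff)
qed

context mallows_line
begin

section \<open>Stationarity and the mean number of fixed points\<close>

lemma prob_coord_tendsto:
  "(\<lambda>n. measure_pmf.prob (mallows {x - int n..x + int n} q) {s. s x = z})
   \<longlonglongrightarrow> prob {w \<in> space M. S w x = z}"
proof -
  have "(\<lambda>n. prob {w \<in> space M. pattern {x - int n..x + int n} (S w) \<in> {s. s x = z}})
     \<longlonglongrightarrow> prob {w \<in> space M. S w x = z}"
  proof (rule prob_tendsto_of_AE_eventually[OF pattern_event])
    show "{w \<in> space M. S w x = z} \<in> events" by measurable
    show "AE w in M. eventually (\<lambda>n. w \<in> {w \<in> space M. pattern {x - int n..x + int n} (S w) \<in> {s. s x = z}}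
        \<longleftrightarrow> w \<in> {w \<in> space M. S w x = z}) sequentially"
      using AE_tame
    proof eventually_elim
      case (elim w)
      from tame_eventually_pattern[OF elim, of x x x] show ?case by eventually_elim simp
    qed
  qed
  then show ?thesis by (simp only: prob_pattern)
qed

text \<open>Windows centred at \<open>x\<close> and at \<open>0\<close> are translates and carry the
  same finite Mallows law up to translation. Both probabilities are limits along such windows, since
  \<open>tame_eventually_pattern\<close> allows any centre.\<close>

lemma stationary: "prob {w \<in> space M. S w x = x + d} = prob {w \<in> space M. S w 0 = d}"
proof -
  have "measure_pmf.prob (mallows {x - int n..x + int n} q) {s. s x = x + d}
      = measure_pmf.prob (mallows {0 - int n..0 + int n} q) {s. s 0 = d}" for n
  proof -
    let ?F = "relabel (\<lambda>y. y + x) (\<lambda>y. y - x) {- int n..int n}"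
    have "mallows {- int n..int n} q = map_pmf ?F (mallows {x - int n..x + int n} q)"
      using mallows_translate[OF q(1), of x "- int n" "int n"] by (simp add: add.commute)
    then have "measure_pmf.prob (mallows {0 - int n..0 + int n} q) {s. s 0 = d}
      = measure_pmf.prob (mallows {x - int n..x + int n} q) (?F -` {s. s 0 = d})" by simp
    also have "?F -` {s. s 0 = d} = {s. s x = x + d}"
      by (auto simp: relabel_def)
    finally show ?thesis by simp
  qed
  then have "(\<lambda>n. measure_pmf.prob (mallows {x - int n..x + int n} q) {s. s x = x + d})
     \<longlonglongrightarrow> prob {w \<in> space M. S w 0 = d}"
    using prob_coord_tendsto[of 0 d] by (simp only:)
  with prob_coord_tendsto[of x "x + d"] show ?thesis by (rule LIMSEQ_unique)
qed

text \<open>By stationarity \<open>P (S x = c - x) = P (S 0 = c - 2 x)\<close>, and \<open>c - 2 x\<close> runs through the integers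
  of the parity of \<open>c\<close>.\<close>
lemma nn_integral_fixed_points:
  "(\<integral>\<^sup>+ w. emeasure (count_space UNIV) {x. S w x = c - x} \<partial>M) = emeasure M {w \<in> space M. even (c - S w 0)}"
proof -
  have ind: "emeasure (count_space UNIV) {x. P x} = (\<integral>\<^sup>+ x. of_bool (P x) \<partial>count_space UNIV)"
    for P :: "int \<Rightarrow> bool"
  proof -
    have "(\<integral>\<^sup>+ x. of_bool (P x) \<partial>count_space UNIV) = (\<integral>\<^sup>+ x. indicator {x. P x} x \<partial>count_space UNIV)"
      by (intro nn_integral_cong) (simp add: indicator_def)
    then show ?thesis by simp
  qed
  \<comment> \<open>Tonelli, in a form used twice: forwards for \<open>S w x = c - x\<close>, and
    backwards for \<open>S w 0 = c - 2 * x\<close> after stationarity.\<close>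
  have sw: "(\<integral>\<^sup>+ w. emeasure (count_space UNIV) {x. S w (f x) = g x} \<partial>M)
      = (\<integral>\<^sup>+ x. emeasure M {w \<in> space M. S w (f x) = g x} \<partial>count_space UNIV)" for f g :: "int \<Rightarrow> int"
  proof -
    have "(\<integral>\<^sup>+ w. emeasure (count_space UNIV) {x. S w (f x) = g x} \<partial>M)
       = (\<integral>\<^sup>+ w. \<integral>\<^sup>+ x. of_bool (S w (f x) = g x) \<partial>count_space UNIV \<partial>M)" by (simp only: ind)
    also have "\<dots> = (\<integral>\<^sup>+ x. \<integral>\<^sup>+ w. of_bool (S w (f x) = g x) \<partial>M \<partial>count_space UNIV)"
      by (rule nn_integral_count_space_nn_integral) (simp, measurable)
    also have "\<dots> = (\<integral>\<^sup>+ x. emeasure M {w \<in> space M. S w (f x) = g x} \<partial>count_space UNIV)"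
    proof (rule nn_integral_cong)
      fix x :: int
      have "(\<integral>\<^sup>+ w. of_bool (S w (f x) = g x) \<partial>M) = (\<integral>\<^sup>+ w. indicator {w \<in> space M. S w (f x) = g x} w \<partial>M)"
        by (intro nn_integral_cong) (auto simp: indicator_def)
      also have "\<dots> = emeasure M {w \<in> space M. S w (f x) = g x}" by (rule nn_integral_indicator) measurable
      finally show "(\<integral>\<^sup>+ w. of_bool (S w (f x) = g x) \<partial>M) = emeasure M {w \<in> space M. S w (f x) = g x}" .
    qed
    finally show ?thesis .
  qed
  have "(\<integral>\<^sup>+ w. emeasure (count_space UNIV) {x. S w x = c - x} \<partial>M)
      = (\<integral>\<^sup>+ x. emeasure M {w \<in> space M. S w x = c - x} \<partial>count_space UNIV)" 
    by (rule sw[of "\<lambda>x. x" "\<lambda>x. c - x"])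
  also have "\<dots> = (\<integral>\<^sup>+ x. emeasure M {w \<in> space M. S w 0 = c - 2 * x} \<partial>count_space UNIV)"
  proof (rule nn_integral_cong)
    fix x
    have "x + (c - 2 * x) = c - x" by simp
    with stationary[of x "c - 2 * x"]
    show "emeasure M {w \<in> space M. S w x = c - x} = emeasure M {w \<in> space M. S w 0 = c - 2 * x}"
      by (simp only: emeasure_eq_measure)
  qed
  also have "\<dots> = (\<integral>\<^sup>+ w. emeasure (count_space UNIV) {x. S w 0 = c - 2 * x} \<partial>M)"
    by (rule sw[of "\<lambda>_. 0" "\<lambda>x. c - 2 * x", symmetric])
  also have "\<dots> = (\<integral>\<^sup>+ w. indicator {w \<in> space M. even (c - S w 0)} w \<partial>M)"
  proof (rule nn_integral_cong)
    fix w assume w: "w \<in> space M"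
    show "emeasure (count_space UNIV) {x. S w 0 = c - 2 * x} = indicator {w \<in> space M. even (c - S w 0)} w"
    proof (cases "even (c - S w 0)")
      case True
      then have "{x. S w 0 = c - 2 * x} = {(c - S w 0) div 2}" by auto
      with True w show ?thesis by simp
    next
      case False
      then have "{x. S w 0 = c - 2 * x} = {}" by auto
      with False show ?thesis by simp
    qed
  qed
  also have "\<dots> = emeasure M {w \<in> space M. even (c - S w 0)}" by (rule nn_integral_indicator) measurable
  finally show ?thesis .
qed

text \<open>Since the first count is almost surely finite, the mean number of fixed points is
  determined by the law of that count. Lists of length one bring the events into the form used in
  the theorem.\<close>

lemma nn_integral_cycle_count_1:
  "(\<integral>\<^sup>+ w. emeasure (count_space UNIV) {x. S w x = c - x} \<partial>M)
   = (\<Sum>m. of_nat m * ennreal (prob {w \<in> space M. odd_cycles UNIV (length [m]) (refl_about c \<circ> S w) = map enat [m]}))"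
proof -
  define E where "E m = {w \<in> space M. odd_cycles UNIV (length [m]) (refl_about c \<circ> S w) = map enat [m]}" for m
  have E: "E m \<in> events" for m unfolding E_def by (rule odd_cycles_event)
  have "AE w in M. emeasure (count_space UNIV) {x. S w x = c - x} = (\<Sum>m. of_nat m * indicator (E m) w)"
    using AE_cycle_count_finite[of c] AE_space
  proof eventually_elim
    case (elim w)
    have fix_eq: "{x. (refl_about c \<circ> S w) x = x} = {x. S w x = c - x}" by (auto simp: refl_about_def)
    from elim(1)[rule_format, of 0] obtain k where "cycle_count UNIV 1 (refl_about c \<circ> S w) = enat k" by auto
    then have k: "finite {x. S w x = c - x}" "card {x. S w x = c - x} = k"
      unfolding cycle_count_1 fix_eq by auto
    have iff: "w \<in> E m \<longleftrightarrow> m = k" for m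
      using elim(2) k cycle_count_1[of "refl_about c \<circ> S w" m] unfolding fix_eq by (auto simp: E_def odd_cycles_def)
    have "(\<Sum>m. of_nat m * indicator (E m) w) = (\<Sum>m\<in>{k}. of_nat m * indicator (E m) w :: ennreal)"
      by (rule suminf_finite) (auto simp: iff)
    also have "\<dots> = of_nat k" using iff by simp
    finally show ?case using k by (simp add: emeasure_count_space)
  qed
  then have "(\<integral>\<^sup>+ w. emeasure (count_space UNIV) {x. S w x = c - x} \<partial>M)
      = (\<integral>\<^sup>+ w. (\<Sum>m. of_nat m * indicator (E m) w) \<partial>M)" by (rule nn_integral_cong_AE)
  also have "\<dots> = (\<Sum>m. \<integral>\<^sup>+ w. of_nat m * indicator (E m) w \<partial>M)"
    using E by (intro nn_integral_suminf) auto
  also have "\<dots> = (\<Sum>m. of_nat m * ennreal (prob (E m)))"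
    using E by (simp add: nn_integral_cmult_indicator emeasure_eq_measure)
  finally show ?thesis by (simp only: E_def)
qed

text \<open>As the window grows, the pattern value at \<open>0\<close> settles at
  \<open>S w 0\<close>, the number of values above it tends to infinity, and the weight tends to
  \<open>C\<close>. By dominated convergence the signed means tend to \<open>C\<close> times this
  expectation.\<close>

lemma expectation_parity_sign_pos: "expectation (\<lambda>w. parity_sign (S w 0)) > 0"
proof -
  obtain C where C: "qratio q \<longlonglongrightarrow> C" "C > 0" "\<And>u. qratio q u \<le> C" using qratio_limit[OF q] by blast
  let ?f = "\<lambda>n s. parity_sign (s 0) * qratio q (nat (int n - s 0))"
  have "(\<lambda>n. expectation (\<lambda>w. ?f n (pattern {- int n..int n} (S w))))
     \<longlonglongrightarrow> expectation (\<lambda>w. parity_sign (S w 0) * C)"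
  proof (rule integral_dominated_convergence[where w = "\<lambda>_. C"])
    show "(\<lambda>w. parity_sign (S w 0) * C) \<in> borel_measurable M"
      by (rule measurable_compose[OF measurable_coord]) simp
    show "(\<lambda>w. ?f n (pattern {- int n..int n} (S w))) \<in> borel_measurable M" for n
      by (rule measurable_compose[OF measurable_pattern]) simp
    show "AE w in M. norm (?f n (pattern {- int n..int n} (S w))) \<le> C" for n
      using C(3) qratio_pos[OF q] by (auto simp: parity_sign_def abs_mult less_imp_le)
    show "AE w in M. (\<lambda>n. ?f n (pattern {- int n..int n} (S w))) \<longlonglongrightarrow> parity_sign (S w 0) * C"
      using pattern_limit
    proof eventually_elim
      case (elim w)
      define z where "z = S w 0"
      have "filterlim (\<lambda>n. nat (int n - z)) at_top sequentially"
        unfolding filterlim_at_top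
      proof
        fix K
        show "eventually (\<lambda>n. K \<le> nat (int n - z)) sequentially"
          by (rule eventually_sequentiallyI[of "K + nat \<bar>z\<bar>"]) auto
      qed
      then have "(\<lambda>n. qratio q (nat (int n - z))) \<longlonglongrightarrow> C" by (rule filterlim_compose[OF C(1)])
      then have "(\<lambda>n. parity_sign z * qratio q (nat (int n - z))) \<longlonglongrightarrow> parity_sign z * C"
        by (rule tendsto_mult_left)
      moreover have "eventually (\<lambda>n. parity_sign z * qratio q (nat (int n - z))
          = ?f n (pattern {- int n..int n} (S w))) sequentially"
        using elim[rule_format, of 0] by eventually_elim (simp add: z_def)
      ultimately show ?case unfolding z_def by (rule Lim_transform_eventually)
    qed
  qed simp
  then have "(\<lambda>n. signed_mean q (- int n) (int n)) \<longlonglongrightarrow> expectation (\<lambda>w. parity_sign (S w 0)) * C"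
    by (simp add: signed_mean_def expectation_pattern[symmetric])
  with signed_mean_limit[OF q]
  have "(1 - q) * qratio_series q (- q) = expectation (\<lambda>w. parity_sign (S w 0)) * C"
    by (rule LIMSEQ_unique[symmetric, THEN sym])
  moreover have "(1 - q) * qratio_series q (- q) > 0" using qratio_series_pos[OF q] q by simp
  ultimately show ?thesis using C(2) by (simp add: zero_less_mult_iff)
qed

text \<open>Equal laws of the first count would have equal means, so \<open>S w 0\<close> would be
  even and odd with the same probability, against the positive mean of its sign.\<close>

lemma distinct_laws:
  "\<exists>m. prob {w \<in> space M. odd_cycles UNIV (length [m]) (refl_about 0 \<circ> S w) = map enat [m]}
     \<noteq> prob {w \<in> space M. odd_cycles UNIV (length [m]) (refl_about 1 \<circ> S w) = map enat [m]}"
proof (rule ccontr)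
  assume "\<not> ?thesis"
  then have "(\<integral>\<^sup>+ w. emeasure (count_space UNIV) {x. S w x = 0 - x} \<partial>M)
      = (\<integral>\<^sup>+ w. emeasure (count_space UNIV) {x. S w x = 1 - x} \<partial>M)"
    unfolding nn_integral_cycle_count_1 by (simp only: not_ex not_not)
  then have eq: "prob {w \<in> space M. even (S w 0)} = prob {w \<in> space M. odd (S w 0)}"
    unfolding nn_integral_fixed_points by (simp add: emeasure_eq_measure)
  have [measurable]: "{w \<in> space M. even (S w 0)} \<in> events" "{w \<in> space M. odd (S w 0)} \<in> events"
    by measurable
  have "expectation (\<lambda>w. parity_sign (S w 0))
     = expectation (\<lambda>w. indicator {w \<in> space M. even (S w 0)} w - indicator {w \<in> space M. odd (S w 0)} w)"
    by (intro Bochner_Integration.integral_cong) (auto simp: parity_sign_def indicator_def)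
  also have "\<dots> = prob {w \<in> space M. even (S w 0)} - prob {w \<in> space M. odd (S w 0)}"
  proof -
    have "integrable M (indicat_real {w \<in> space M. even (S w 0)})"
      "integrable M (indicat_real {w \<in> space M. odd (S w 0)})"
      by (rule integrable_real_indicator; simp add: emeasure_eq_measure)+
    then show ?thesis by simp
  qed
  finally show False using eq expectation_parity_sign_pos by simp
qed

end

lemma refl_eq: "refl_r = refl_about 0" "refl_rho = refl_about 1"
  by (auto simp: refl_r_def refl_rho_def refl_about_def)

theorem theorem1p3:
  fixes q :: real and M :: "'a measure" and S :: "'a \<Rightarrow> int \<Rightarrow> int"
  assumes "q > 1"
    and "is_mallows_Z M S (1 / q)"
  shows "(AE w in M. \<forall>j. cycle_count UNIV (2 * j + 1) (refl_r \<circ> S w) \<noteq> \<infinity>)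
       \<and> (AE w in M. \<forall>j. cycle_count UNIV (2 * j + 1) (refl_rho \<circ> S w) \<noteq> \<infinity>)
       \<and> (\<forall>xs :: nat list.
            (\<lambda>n. measure_pmf.prob (mallows {1..int (2 * n + 1)} q)
                   {p. odd_cycles {1..int (2 * n + 1)} (length xs) p = map enat xs})
            \<longlonglongrightarrow> measure M {w \<in> space M. odd_cycles UNIV (length xs) (refl_r \<circ> S w) = map enat xs})
       \<and> (\<forall>xs :: nat list.
            (\<lambda>n. measure_pmf.prob (mallows {1..int (2 * n)} q)
                   {p. odd_cycles {1..int (2 * n)} (length xs) p = map enat xs})
            \<longlonglongrightarrow> measure M {w \<in> space M. odd_cycles UNIV (length xs) (refl_rho \<circ> S w) = map enat xs})
       \<and> (\<exists>xs :: nat list.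
            measure M {w \<in> space M. odd_cycles UNIV (length xs) (refl_r \<circ> S w) = map enat xs}
            \<noteq> measure M {w \<in> space M. odd_cycles UNIV (length xs) (refl_rho \<circ> S w) = map enat xs})"
proof -
  interpret prob_space M using assms by (simp add: is_mallows_Z_def)
  interpret mallows_line M S "1 / q"
    by unfold_locales (use assms in \<open>auto simp: is_mallows_Z_def\<close>)
  have q0: "q > 0" using assms by simp
  have lim: "(\<lambda>n. measure_pmf.prob (mallows {1..2 * int n + 1 - c} q)
        {p. odd_cycles {1..2 * int n + 1 - c} (length xs) p = map enat xs})
      \<longlonglongrightarrow> measure M {w \<in> space M. odd_cycles UNIV (length xs) (refl_about c \<circ> S w) = map enat xs}" for c xs
    unfolding prob_odd_cycles_reverse[OF q0] by (rule odd_cycles_limit)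
  \<comment> \<open>\<open>c = 0\<close> gives the odd sizes with \<open>refl_r\<close>, and
    \<open>c = 1\<close> the even sizes with \<open>refl_rho\<close>.\<close>
  have int_eq: "int (2 * n + 1) = 2 * int n + 1 - 0" "int (2 * n) = 2 * int n + 1 - 1" for n by auto
  show ?thesis
    unfolding refl_eq int_eq
    by (intro conjI allI AE_cycle_count_finite lim) (use distinct_laws in blast)
qed

end
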